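(* Let $X$ be a $T_0$ topological space and let $\alpha\colon\mathcal V_{\mathrm f}X\to X$ be a continuous map. If $(X,\alpha)$ is a $\mathcal V_{\mathrm f}$-algebra, then $X$, with the operations $x+y=\alpha(\delta_x+\delta_y)$ and $r\cdot x=\alpha(r\delta_x)$ ($x,y\in X$, $r\in\mathbb R_+$), is a weakly locally convex topological cone, and $\alpha$ is the standard barycentre map $\sum_{i=1}^nr_i\delta_{x_i}\mapsto\sum_{i=1}^nr_ix_i$. Conversely, for every weakly locally convex topological cone $C$, there exists a (unique) continuous linear map $\alpha\colon\mathcal V_{\mathrm f}C\to C$ sending each simple valuation $\sum_{i=1}^nr_i\delta_{x_i}$ to its (standard) barycentre $\sum_{i=1}^nr_ix_i$, and the pair $(C,\alpha)$ is a $\mathcal V_{\mathrm f}$-algebra.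
   Context: $\mathbb R_+=[0,\infty)$ and $\overline{\mathbb R}_+=[0,\infty]$, both with the Scott topology (proper nonempty opens are the sets of elements $>r$, $r\in\mathbb R_+$). $\mathbf{TOP}_0$ is the category of $T_0$ topological spaces and continuous maps. Valuations. For a space $X$ with lattice of opens $\mathcal OX$ and $x\in X$, the Dirac mass $\delta_x\colon\mathcal OX\to\overline{\mathbb R}_+$ is $\delta_x(U)=1$ if $x\in U$, and $0$ otherwise. A simple valuation on $X$ is a finite linear combination $\sum_{i=1}^nr_i\delta_{x_i}$ ($r_i\in\mathbb R_+$, $x_i\in X$), computed pointwise. $\mathcal V_{\mathrm f}X$ is the set of simple valuations on $X$ with the (weak) topology generated by the subbasic sets $\{\mu\mid\mu(U)>r\}$, $U\in\mathcal OX$, $r\in\mathbb R_+$; it is a cone under pointwise operations. For continuous $h\colon X\to\overline{\mathbb R}_+$ and a valuation $\mu$, $\int h\,d\mu=\int_0^\infty\mu(h^{-1}((r,\infty]))\,dr$; for simple $\mu=\sum r_i\delta_{x_i}$ this equals $\sum r_ih(x_i)$. The monad. $\mathcal V_{\mathrm f}$ is a monad on $\mathbf{TOP}_0$, with $\mathcal V_{\mathrm f}f(\mu)(V)=\mu(f^{-1}(V))$, unit $\eta_X(x)=\delta_x$, and multiplication $m_X(\varpi)(U)=\int_{\mu\in\mathcal V_{\mathrm f}X}\mu(U)\,d\varpi$ for $\varpi\in\mathcal V_{\mathrm f}\mathcal V_{\mathrm f}X$. A $\mathcal V_{\mathrm f}$-algebra is a pair $(X,\alpha)$ of a $T_0$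 space $X$ and a continuous map $\alpha\colon\mathcal V_{\mathrm f}X\to X$ with $\alpha\circ\eta_X=\mathrm{id}_X$ and $\alpha\circ m_X=\alpha\circ\mathcal V_{\mathrm f}\alpha$. Cones. A cone is a commutative monoid $(C,+,0)$ with a scalar multiplication $\mathbb R_+\times C\to C$ such that $r(x+y)=rx+ry$, $(r+s)x=rx+sx$, $(rs)x=r(sx)$, $1x=x$, $0x=0$, $r0=0$. A topological cone is a cone with a $T_0$ topology making $+$ and scalar multiplication jointly continuous. A map $f$ between cones is linear if $f(rx+sy)=rf(x)+sf(y)$ for all $r,s\in\mathbb R_+$. A subset $A$ of a cone is convex if $ra+(1-r)b\in A$ for all $a,b\in A$, $r\in[0,1]$. A cone with a $T_0$ topology is weakly locally convex if for every point $x$, every open neighbourhood of $x$ contains a convex (not necessarily open) neighbourhood of $x$. *)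

theory Defs
  imports "HOL-Analysis.Analysis" "HOL-Algebra.FiniteProduct"
begin

section \<open>The Scott topology on the nonnegative reals\<close>

lemma istopology_scott_nonneg:
  "istopology (\<lambda>U::real set. U = {} \<or> U = {0..} \<or> (\<exists>r\<ge>0. U = {r<..}))" (is "istopology ?P")
proof -
  have int_Ioi: "{r<..} \<inter> {s<..} = {max r s<..}" for r s :: real
    by auto
  have int_Ici: "{0..} \<inter> {r<..} = {r<..}" "{r<..} \<inter> {0..} = {r<..}" if "r \<ge> 0" for r :: real
    using that by auto
  have inter: "?P (S \<inter> T)" if S: "?P S" and T: "?P T" for S T
  proof -
    consider "S = {}" | "T = {}" | "S = {0..}" "T = {0..}"
      | r where "r \<ge> 0" "S = {0..}" "T = {r<..}" | r where "r \<ge> 0" "S = {r<..}" "T = {0..}"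
      | r s where "r \<ge> 0" "s \<ge> 0" "S = {r<..}" "T = {s<..}"
      using S T by metis
    then show ?thesis
    proof cases
      case (6 r s)
      then have "S \<inter> T = {max r s<..}" "max r s \<ge> 0"
        using int_Ioi by auto
      then show ?thesis by blast
    qed (use int_Ici in auto)
  qed
  have union: "?P (\<Union>K)" if K: "\<And>S. S \<in> K \<Longrightarrow> ?P S" for K
  proof (cases "{0..} \<in> K")
    case True
    have "S \<subseteq> {0..}" if "S \<in> K" for S
      using K[OF that] by auto
    with True have "\<Union>K = {0..}" by blast
    then show ?thesis by blast
  next
    case False
    define R where "R = {r. r \<ge> 0 \<and> {r<..} \<in> K}"
    have *: "\<Union>K = (\<Union>r\<in>R. {r<..})"
    proof
      show "\<Union>K \<subseteq> (\<Union>r\<in>R. {r<..})"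
        using K False unfolding R_def by fastforce
    qed (auto simp: R_def)
    show ?thesis
    proof (cases "R = {}")
      case True
      then show ?thesis using * by simp
    next
      case nonempty: False
      have bdd: "bdd_below R"
        by (auto simp: R_def bdd_below_def)
      have "\<Union>K = {Inf R<..}"
        unfolding * using cInf_less_iff[OF nonempty bdd] by auto
      moreover have "Inf R \<ge> 0"
        using nonempty by (intro cInf_greatest) (auto simp: R_def)
      ultimately show ?thesis by blast
    qed
  qed
  show ?thesis
    unfolding istopology_def
  proof (intro conjI allI impI)
    fix S T
    assume "?P S" "?P T"
    then show "?P (S \<inter> T)" by (rule inter)
  next
    fix K
    assume "\<forall>S\<in>K. ?P S"
    then show "?P (\<Union>K)" by (intro union) (rule bspec)
  qed
qed

definition scott_nonneg :: "real topology" where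
  "scott_nonneg = topology (\<lambda>U. U = {} \<or> U = {0..} \<or> (\<exists>r\<ge>0. U = {r<..}))"

lemma openin_scott_nonneg:
  "openin scott_nonneg U \<longleftrightarrow> U = {} \<or> U = {0..} \<or> (\<exists>r\<ge>0. U = {r<..})"
  unfolding scott_nonneg_def by (subst topology_inverse'[OF istopology_scott_nonneg]) simp

lemma topspace_scott_nonneg [simp]: "topspace scott_nonneg = {0..}"
  unfolding topspace_def openin_scott_nonneg by auto

section \<open>Simple valuations\<close>

text \<open>
  A valuation on a space \<open>X\<close> is represented as a function on all subsets that vanishes outside
  the lattice of open sets of \<open>X\<close>. This makes equality of functions coincide with equality of
  valuations, and is preserved by the pointwise operations.
\<close>

definition dirac :: "'a topology \<Rightarrow> 'a \<Rightarrow> 'a set \<Rightarrow> ennreal" where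
  "dirac X x U = (if openin X U \<and> x \<in> U then 1 else 0)"

definition val_add :: "('a set \<Rightarrow> ennreal) \<Rightarrow> ('a set \<Rightarrow> ennreal) \<Rightarrow> 'a set \<Rightarrow> ennreal" where
  "val_add \<mu> \<nu> U = \<mu> U + \<nu> U"

definition val_scale :: "real \<Rightarrow> ('a set \<Rightarrow> ennreal) \<Rightarrow> 'a set \<Rightarrow> ennreal" where
  "val_scale r \<mu> U = ennreal r * \<mu> U"

definition dirac_sum :: "'a topology \<Rightarrow> nat \<Rightarrow> (nat \<Rightarrow> real) \<Rightarrow> (nat \<Rightarrow> 'a) \<Rightarrow> 'a set \<Rightarrow> ennreal" where
  "dirac_sum X n r x U = (\<Sum>i<n. ennreal (r i) * dirac X (x i) U)"

definition simple_valuations :: "'a topology \<Rightarrow> ('a set \<Rightarrow> ennreal) set" where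
  "simple_valuations X =
     {dirac_sum X n r x | n r x. \<forall>i<n. 0 \<le> r i \<and> x i \<in> topspace X}"

text \<open>The whole set is listed among the generators because the zero valuation lies in no
  subbasic open set.\<close>

definition Vf :: "'a topology \<Rightarrow> ('a set \<Rightarrow> ennreal) topology" where
  "Vf X = topology_generated_by
     (insert (simple_valuations X)
       {{\<mu> \<in> simple_valuations X. \<mu> U > ennreal r} | U r. openin X U \<and> 0 \<le> r})"

lemma topspace_Vf [simp]: "topspace (Vf X) = simple_valuations X"
  unfolding Vf_def topology_generated_by_topspace by auto

text \<open>The (Choquet) integral of a function \<open>h\<close> that is continuous from \<open>X\<close> to the extended
  nonnegative reals with the Scott topology. The integrand is an antitone function of \<open>r\<close>, so that
  its Riemann and Lebesgue integrals agree.\<close>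

definition val_integral :: "'a topology \<Rightarrow> ('a set \<Rightarrow> ennreal) \<Rightarrow> ('a \<Rightarrow> ennreal) \<Rightarrow> ennreal" where
  "val_integral X \<mu> h = (\<integral>\<^sup>+r\<in>{0..}. \<mu> {x \<in> topspace X. h x > ennreal r} \<partial>lborel)"

lemma val_integral_dirac_sum:
  assumes h: "\<And>r. 0 \<le> r \<Longrightarrow> openin X {x \<in> topspace X. h x > ennreal r}"
    and x: "\<And>i. i < n \<Longrightarrow> x i \<in> topspace X"
  shows "val_integral X (dirac_sum X n r x) h = (\<Sum>i<n. ennreal (r i) * h (x i))"
proof -
  have meas: "{t. 0 \<le> t \<and> ennreal t < c} \<in> sets lborel" for c
    by measurable
  have len: "emeasure lborel {t. 0 \<le> t \<and> ennreal t < c} = c" for c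
  proof (cases c)
    case (real d)
    then have "{t. 0 \<le> t \<and> ennreal t < c} = {0..<d}"
      by (auto simp: ennreal_less_iff)
    with real show ?thesis by simp
  next
    case top
    then have "{t. 0 \<le> t \<and> ennreal t < c} = {0..}" by auto
    moreover have "emeasure lborel {0::real..} = \<infinity>"
    proof (rule ccontr)
      assume "emeasure lborel {0::real..} \<noteq> \<infinity>"
      then obtain b where b: "0 \<le> b" "emeasure lborel {0::real..} = ennreal b"
        by (cases "emeasure lborel {0::real..}") auto
      have "emeasure lborel {0..b+1} \<le> emeasure lborel {0::real..}"
        by (intro emeasure_mono) auto
      with b show False by simp
    qed
    ultimately show ?thesis using top by simp
  qed
  have eq: "dirac_sum X n r x {y \<in> topspace X. h y > ennreal t} * indicator {0..} t =
      (\<Sum>i<n. ennreal (r i) * indicator {t. 0 \<le> t \<and> ennreal t < h (x i)} t)" for t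
  proof (cases "0 \<le> t")
    case True
    have "dirac X (x i) {y \<in> topspace X. h y > ennreal t} =
        indicator {t. 0 \<le> t \<and> ennreal t < h (x i)} t" if "i < n" for i
      using h[OF True] x[OF that] True by (simp add: dirac_def)
    then show ?thesis
      using True by (simp add: dirac_sum_def)
  qed simp
  have "val_integral X (dirac_sum X n r x) h =
      (\<integral>\<^sup>+t. (\<Sum>i<n. ennreal (r i) * indicator {t. 0 \<le> t \<and> ennreal t < h (x i)} t) \<partial>lborel)"
    unfolding val_integral_def eq ..
  also have "\<dots> = (\<Sum>i<n. \<integral>\<^sup>+t. ennreal (r i) * indicator {t. 0 \<le> t \<and> ennreal t < h (x i)} t \<partial>lborel)"
    by (intro nn_integral_sum) measurable
  also have "\<dots> = (\<Sum>i<n. ennreal (r i) * h (x i))"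
    using meas by (intro sum.cong) (simp_all add: nn_integral_cmult_indicator len)
  finally show ?thesis .
qed

section \<open>The monad of simple valuations and its algebras\<close>

definition Vf_map :: "'a topology \<Rightarrow> 'b topology \<Rightarrow> ('a \<Rightarrow> 'b) \<Rightarrow>
    ('a set \<Rightarrow> ennreal) \<Rightarrow> 'b set \<Rightarrow> ennreal" where
  "Vf_map X Y f \<mu> V = (if openin Y V then \<mu> {x \<in> topspace X. f x \<in> V} else 0)"

definition Vf_mult :: "'a topology \<Rightarrow> (('a set \<Rightarrow> ennreal) set \<Rightarrow> ennreal) \<Rightarrow> 'a set \<Rightarrow> ennreal" where
  "Vf_mult X \<Phi> U = (if openin X U then val_integral (Vf X) \<Phi> (\<lambda>\<mu>. \<mu> U) else 0)"

definition Vf_algebra :: "'a topology \<Rightarrow> (('a set \<Rightarrow> ennreal) \<Rightarrow> 'a) \<Rightarrow> bool" where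
  "Vf_algebra X \<alpha> \<longleftrightarrow>
     t0_space X \<and> continuous_map (Vf X) X \<alpha> \<and>
     (\<forall>x\<in>topspace X. \<alpha> (dirac X x) = x) \<and>
     (\<forall>\<Phi>\<in>topspace (Vf (Vf X)). \<alpha> (Vf_mult X \<Phi>) = \<alpha> (Vf_map (Vf X) X \<alpha> \<Phi>))"

section \<open>Cones\<close>

text \<open>Only the values of \<open>smul\<close> at nonnegative scalars matter. The qualified name refers to the
  carrier-based commutative monoids, not to those on a whole type.\<close>

locale abstract_cone =
  fixes C :: "'a set" and add :: "'a \<Rightarrow> 'a \<Rightarrow> 'a" and zero :: 'a and smul :: "real \<Rightarrow> 'a \<Rightarrow> 'a"
  assumes add_monoid: "Group.comm_monoid \<lparr>carrier = C, monoid.mult = add, one = zero\<rparr>"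
    and smul_closed: "\<lbrakk>0 \<le> r; x \<in> C\<rbrakk> \<Longrightarrow> smul r x \<in> C"
    and smul_add_right: "\<lbrakk>0 \<le> r; x \<in> C; y \<in> C\<rbrakk> \<Longrightarrow> smul r (add x y) = add (smul r x) (smul r y)"
    and smul_add_left: "\<lbrakk>0 \<le> r; 0 \<le> s; x \<in> C\<rbrakk> \<Longrightarrow> smul (r + s) x = add (smul r x) (smul s x)"
    and smul_smul: "\<lbrakk>0 \<le> r; 0 \<le> s; x \<in> C\<rbrakk> \<Longrightarrow> smul (r * s) x = smul r (smul s x)"
    and smul_one: "x \<in> C \<Longrightarrow> smul 1 x = x"
    and smul_zero_left: "x \<in> C \<Longrightarrow> smul 0 x = zero"
    and smul_zero_right: "0 \<le> r \<Longrightarrow> smul r zero = zero"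

locale topological_cone = abstract_cone "topspace X" add zero smul
  for X :: "'a topology" and add zero smul +
  assumes t0: "t0_space X"
    and continuous_add: "continuous_map (prod_topology X X) X (\<lambda>(x, y). add x y)"
    and continuous_smul: "continuous_map (prod_topology scott_nonneg X) X (\<lambda>(r, x). smul r x)"

definition cone_convex :: "('a \<Rightarrow> 'a \<Rightarrow> 'a) \<Rightarrow> (real \<Rightarrow> 'a \<Rightarrow> 'a) \<Rightarrow> 'a set \<Rightarrow> bool" where
  "cone_convex add smul A \<longleftrightarrow>
     (\<forall>a\<in>A. \<forall>b\<in>A. \<forall>r\<in>{0..1}. add (smul r a) (smul (1 - r) b) \<in> A)"

locale weakly_locally_convex_topological_cone = topological_cone +
  assumes weakly_locally_convex: "neighbourhood_base_of (cone_convex add smul) X"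

definition cone_linear :: "'a set \<Rightarrow> ('a \<Rightarrow> 'a \<Rightarrow> 'a) \<Rightarrow> (real \<Rightarrow> 'a \<Rightarrow> 'a) \<Rightarrow>
    ('b \<Rightarrow> 'b \<Rightarrow> 'b) \<Rightarrow> (real \<Rightarrow> 'b \<Rightarrow> 'b) \<Rightarrow> ('a \<Rightarrow> 'b) \<Rightarrow> bool" where
  "cone_linear C addC smulC addD smulD f \<longleftrightarrow>
     (\<forall>x\<in>C. \<forall>y\<in>C. \<forall>r\<ge>0. \<forall>s\<ge>0.
        f (addC (smulC r x) (smulC s y)) = addD (smulD r (f x)) (smulD s (f y)))"

definition cone_combination :: "'a set \<Rightarrow> ('a \<Rightarrow> 'a \<Rightarrow> 'a) \<Rightarrow> 'a \<Rightarrow> (real \<Rightarrow> 'a \<Rightarrow> 'a) \<Rightarrow>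
    nat \<Rightarrow> (nat \<Rightarrow> real) \<Rightarrow> (nat \<Rightarrow> 'a) \<Rightarrow> 'a" where
  "cone_combination C add zero smul n r x =
     finprod \<lparr>carrier = C, monoid.mult = add, one = zero\<rparr> (\<lambda>i. smul (r i) (x i)) {..<n}"

definition is_barycentre_map :: "'a topology \<Rightarrow> ('a \<Rightarrow> 'a \<Rightarrow> 'a) \<Rightarrow> 'a \<Rightarrow> (real \<Rightarrow> 'a \<Rightarrow> 'a) \<Rightarrow>
    (('a set \<Rightarrow> ennreal) \<Rightarrow> 'a) \<Rightarrow> bool" where
  "is_barycentre_map X add zero smul \<alpha> \<longleftrightarrow>
     (\<forall>n r x. (\<forall>i<n. 0 \<le> r i \<and> x i \<in> topspace X) \<longrightarrow>
        \<alpha> (dirac_sum X n r x) = cone_combination (topspace X) add zero smul n r x)"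

text \<open>Maps out of a space are total functions of the underlying type, so uniqueness of maps out of
  \<open>Vf C\<close> means agreement on \<open>topspace (Vf C)\<close>.\<close>

definition is_continuous_linear_barycentre_map :: "'a topology \<Rightarrow> ('a \<Rightarrow> 'a \<Rightarrow> 'a) \<Rightarrow> 'a \<Rightarrow>
    (real \<Rightarrow> 'a \<Rightarrow> 'a) \<Rightarrow> (('a set \<Rightarrow> ennreal) \<Rightarrow> 'a) \<Rightarrow> bool" where
  "is_continuous_linear_barycentre_map C add zero smul \<alpha> \<longleftrightarrow>
     continuous_map (Vf C) C \<alpha> \<and>
     cone_linear (topspace (Vf C)) val_add val_scale add smul \<alpha> \<and>
     is_barycentre_map C add zero smul \<alpha>"

end

theory Submission
  imports Defs
begin

text \<open>An algebra \<open>\<alpha>\<close> is a linear retraction of \<open>Vf X\<close> onto \<open>X\<close>, so the cone laws, the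
  continuity of the operations and local convexity all descend from \<open>Vf X\<close>. For the converse, let
  \<open>\<Sum>j. s j * \<delta>(y j)\<close> be close to \<open>\<Sum>i. r i * \<delta>(x i)\<close>. A fractional form of Hall's theorem moves
  almost all of the mass \<open>r i\<close> at each \<open>x i\<close> to points \<open>y j\<close> near \<open>x i\<close>, so by weak local convexity
  \<open>\<Sum>j. s j * y j\<close> lies, in the specialization order, above a combination of points near the
  \<open>x i\<close> with coefficients near the \<open>r i\<close>.\<close>

section \<open>Fractional matchings\<close>

text \<open>The obstacle to continuity of barycentres is that neighbourhoods of different points
  \<open>x i\<close> may overlap, and a \<open>T\<^sub>0\<close> space need not allow them to be
  made disjoint. The mass of a nearby valuation in an overlap has no canonical owner, so a division
  of it must be found. The topology of \<open>Vf X\<close> controls the mass of finitely many open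
  sets from below; asking, for every nonempty set \<open>K\<close> of indices, that the union of the
  neighbourhoods over \<open>K\<close> has mass above the sum of the coefficients over
  \<open>K\<close> is a strict form of Hall's condition for such a division. Strictness costs a
  little of each coefficient, which Scott continuity of scalar multiplication affords. Mass left
  over by the division cannot be subtracted in a cone, but it does no harm: 0 is the least element
  of the specialization order and open sets are upward closed.\<close>

text \<open>If some demand or supply vanishes, or Hall's condition is tight for a proper nonempty set of
  demands, the problem shrinks or splits. Otherwise mass is sent along one edge \<open>(i, j)\<close> until
  this happens; only sets \<open>K\<close> with \<open>i \<notin> K\<close> and \<open>j\<close> in their neighbourhood lose slack.\<close>

lemma fractional_hall:
  fixes d :: "'i \<Rightarrow> real" and s :: "'j \<Rightarrow> real" and E :: "'i \<Rightarrow> 'j \<Rightarrow> bool"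
  assumes "finite I" "finite J" "\<And>i. i \<in> I \<Longrightarrow> 0 \<le> d i" "\<And>j. j \<in> J \<Longrightarrow> 0 \<le> s j"
    and "\<And>K. K \<subseteq> I \<Longrightarrow> sum d K \<le> sum s {j\<in>J. \<exists>i\<in>K. E i j}"
  shows "\<exists>t. (\<forall>i\<in>I. \<forall>j\<in>J. 0 \<le> t i j \<and> (t i j \<noteq> 0 \<longrightarrow> E i j)) \<and>
             (\<forall>i\<in>I. sum (t i) J = d i) \<and> (\<forall>j\<in>J. (\<Sum>i\<in>I. t i j) \<le> s j)"
  using assms
proof (induction "card I + card J" arbitrary: I J d s rule: less_induct)
  case less
  define hall where "hall I J d s \<longleftrightarrow> (\<forall>i\<in>I. 0 \<le> d i) \<and> (\<forall>j\<in>J. 0 \<le> s j) \<and>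
    (\<forall>K\<subseteq>I. sum d K \<le> sum s {j\<in>J. \<exists>i\<in>K. E i j})"
    for I J and d :: "'i \<Rightarrow> real" and s :: "'j \<Rightarrow> real"
  define sol where "sol I J d s \<longleftrightarrow> (\<exists>t. (\<forall>i\<in>I. \<forall>j\<in>J. 0 \<le> t i j \<and> (t i j \<noteq> 0 \<longrightarrow> E i j)) \<and>
             (\<forall>i\<in>I. sum (t i) J = d i) \<and> (\<forall>j\<in>J. (\<Sum>i\<in>I. t i j) \<le> s j))"
    for I J and d :: "'i \<Rightarrow> real" and s :: "'j \<Rightarrow> real"
  define N where "N K = {j\<in>J. \<exists>i\<in>K. E i j}" for K
  have fin: "finite I" "finite J" by fact+
  have IH: "sol I' J' d' s'"
    if "card I' + card J' < card I + card J" "finite I'" "finite J'" "hall I' J' d' s'" for I' J' d' s'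
    unfolding sol_def using that less.hyps[of I' J' d' s'] unfolding hall_def by blast
  \<comment> \<open>The weights are arbitrary here because this is applied both to the given weights
    and to those left after mass has been sent. Sending mass keeps \<open>I\<close> and
    \<open>J\<close>, so by itself it does not decrease the induction measure.\<close>
  have reduce: "sol I J d s"
    if H: "hall I J d s"
      and red: "(\<exists>i\<in>I. d i = 0) \<or> (\<exists>j\<in>J. s j = 0) \<or> (\<exists>K\<subset>I. K \<noteq> {} \<and> sum d K = sum s (N K))"
    for d s
  proof -
    have d0: "\<And>i. i \<in> I \<Longrightarrow> 0 \<le> d i" and s0: "\<And>j. j \<in> J \<Longrightarrow> 0 \<le> s j"
      and Hs: "\<And>K. K \<subseteq> I \<Longrightarrow> sum d K \<le> sum s (N K)"
      using H unfolding hall_def N_def by auto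
    consider i where "i \<in> I" "d i = 0" | j where "j \<in> J" "s j = 0"
      | K where "K \<subset> I" "K \<noteq> {}" "sum d K = sum s (N K)"
      using red by blast
    then show ?thesis
    proof cases
      case (1 i)
      have "card (I - {i}) < card I"
        using 1 fin by (intro psubset_card_mono) auto
      moreover have "hall (I - {i}) J d s"
        using H unfolding hall_def by (simp add: subset_Diff_insert)
      ultimately have "sol (I - {i}) J d s"
        using fin by (intro IH) auto
      then obtain t where t: "\<forall>i\<in>I-{i}. \<forall>j\<in>J. 0 \<le> t i j \<and> (t i j \<noteq> 0 \<longrightarrow> E i j)"
          "\<forall>i\<in>I-{i}. sum (t i) J = d i" "\<forall>j\<in>J. (\<Sum>i\<in>I-{i}. t i j) \<le> s j"
        unfolding sol_def by blast
      have "(\<Sum>k\<in>I. (t(i := \<lambda>_. 0)) k j) = (\<Sum>k\<in>I-{i}. t k j)" for j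
        using 1 fin by (simp add: sum.remove)
      with t 1 show ?thesis
        unfolding sol_def by (intro exI[of _ "t(i := \<lambda>_. 0)"]) auto
    next
      case (2 j)
      have "card (J - {j}) < card J"
        using 2 fin by (intro psubset_card_mono) auto
      moreover have "sum s {j'\<in>J - {j}. \<exists>i\<in>K. E i j'} = sum s {j'\<in>J. \<exists>i\<in>K. E i j'}" for K
        using 2 fin by (intro sum.mono_neutral_left) auto
      then have "hall I (J - {j}) d s"
        using H unfolding hall_def by simp
      ultimately have "sol I (J - {j}) d s"
        using fin by (intro IH) auto
      then obtain t where t: "\<forall>i\<in>I. \<forall>j\<in>J-{j}. 0 \<le> t i j \<and> (t i j \<noteq> 0 \<longrightarrow> E i j)"
          "\<forall>i\<in>I. sum (t i) (J-{j}) = d i" "\<forall>j\<in>J-{j}. (\<Sum>i\<in>I. t i j) \<le> s j"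
        unfolding sol_def by blast
      have "(\<Sum>k\<in>J. ((t i)(j := 0)) k) = sum (t i) (J-{j})" for i
        using 2 fin by (simp add: sum.remove)
      moreover have "(\<Sum>i\<in>I. ((t i)(j := 0)) l) = (if l = j then 0 else \<Sum>i\<in>I. t i l)" for l
        by simp
      ultimately show ?thesis
        using t 2 unfolding sol_def by (intro exI[of _ "\<lambda>i. (t i)(j := 0)"]) simp
    next
      case (3 K)
      have finK: "finite K" "finite (N L)" "N L \<subseteq> J" for L
        using 3 fin by (auto simp: N_def intro: finite_subset)
      have "sol K (N K) d s"
      proof (rule IH)
        have "card K < card I" "card (N K) \<le> card J"
          using 3 fin finK by (auto intro!: psubset_card_mono card_mono)
        then show "card K + card (N K) < card I + card J" by simp
        have "{j \<in> N K. \<exists>i\<in>L. E i j} = N L" if "L \<subseteq> K" for L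
          using that by (auto simp: N_def)
        then show "hall K (N K) d s"
          using d0 s0 Hs 3 finK(3) unfolding hall_def by (auto simp: psubset_eq subset_iff)
      qed (use finK in auto)
      then obtain t where t: "\<forall>i\<in>K. \<forall>j\<in>N K. 0 \<le> t i j \<and> (t i j \<noteq> 0 \<longrightarrow> E i j)"
          "\<forall>i\<in>K. sum (t i) (N K) = d i" "\<forall>j\<in>N K. (\<Sum>i\<in>K. t i j) \<le> s j"
        unfolding sol_def by blast
      have "sol (I - K) (J - N K) d s"
      proof (rule IH)
        have "card (I - K) < card I" "card (J - N K) \<le> card J"
          using 3 fin by (auto intro!: psubset_card_mono card_mono)
        then show "card (I - K) + card (J - N K) < card I + card J" by simp
        \<comment> \<open>Hall's condition for \<open>L \<union> K\<close>, minus the equality for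
          the tight set \<open>K\<close>, is Hall's condition for \<open>L\<close> in the remaining
          problem.\<close>
        have "sum d L \<le> sum s {j \<in> J - N K. \<exists>i\<in>L. E i j}" if L: "L \<subseteq> I - K" for L
        proof -
          have "sum d L + sum d K = sum d (L \<union> K)"
            using L fin finK by (intro sum.union_disjoint[symmetric]) (auto intro: finite_subset)
          also have "\<dots> \<le> sum s (N (L \<union> K))"
            using L 3 by (intro Hs) auto
          also have "N (L \<union> K) = {j \<in> J - N K. \<exists>i\<in>L. E i j} \<union> N K"
            by (auto simp: N_def)
          also have "sum s \<dots> = sum s {j \<in> J - N K. \<exists>i\<in>L. E i j} + sum s (N K)"
            using fin finK by (intro sum.union_disjoint) auto
          finally show ?thesis using 3 by simp
        qed
        then show "hall (I - K) (J - N K) d s"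
          using d0 s0 unfolding hall_def by auto
      qed (use fin in auto)
      then obtain u where u: "\<forall>i\<in>I - K. \<forall>j\<in>J - N K. 0 \<le> u i j \<and> (u i j \<noteq> 0 \<longrightarrow> E i j)"
          "\<forall>i\<in>I - K. sum (u i) (J - N K) = d i" "\<forall>j\<in>J - N K. (\<Sum>i\<in>I - K. u i j) \<le> s j"
        unfolding sol_def by blast
      \<comment> \<open>The mixed blocks stay empty: no edge leads from \<open>K\<close> out of
        \<open>N K\<close>, and by tightness the demands in \<open>K\<close> use up all supplies in
        \<open>N K\<close>.\<close>
      define v where "v i j = (if i \<in> K then if j \<in> N K then t i j else 0
          else if j \<in> N K then 0 else u i j)" for i j
      have split_J: "sum f J = sum f (N K) + sum f (J - N K)" for f :: "'j \<Rightarrow> real"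
        using fin finK(3) by (metis add.commute sum.subset_diff)
      have split_I: "sum f I = sum f K + sum f (I - K)" for f :: "'i \<Rightarrow> real"
        using fin 3 by (metis add.commute sum.subset_diff psubsetE)
      show ?thesis
        unfolding sol_def
      proof (intro exI[of _ v] conjI ballI)
        fix i assume "i \<in> I"
        then show "sum (v i) J = d i"
          by (cases "i \<in> K") (use t(2) u(2) in \<open>simp_all add: split_J v_def\<close>)
      next
        fix j assume "j \<in> J"
        then show "(\<Sum>i\<in>I. v i j) \<le> s j"
          by (cases "j \<in> N K") (use t(3) u(3) in \<open>simp_all add: split_I v_def\<close>)
      qed (use t(1) u(1) in \<open>auto simp: v_def\<close>)
    qed
  qed
  have H: "hall I J d s"
    using less.prems unfolding hall_def by auto
  have "sol I J d s"
  proof (cases "I = {}")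
    case True
    then show ?thesis using less.prems(4) unfolding sol_def by auto
  next
    case False
    then obtain i where i: "i \<in> I" by blast
    show ?thesis
    proof (cases "(\<exists>i\<in>I. d i = 0) \<or> (\<exists>j\<in>J. s j = 0) \<or> (\<exists>K\<subset>I. K \<noteq> {} \<and> sum d K = sum s (N K))")
      case True
      then show ?thesis by (intro reduce H)
    next
      case irred: False
      have pos: "\<And>i. i \<in> I \<Longrightarrow> 0 < d i" "\<And>j. j \<in> J \<Longrightarrow> 0 < s j"
        using irred less.prems(3,4) by (auto simp: less_le)
      have Hs: "\<And>K. K \<subseteq> I \<Longrightarrow> sum d K \<le> sum s (N K)"
        using less.prems(5) unfolding N_def by auto
      have "0 < sum s (N {i})"
        using pos(1)[OF i] Hs[of "{i}"] i by simp
      then have "N {i} \<noteq> {}" by (intro notI) simp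
      then obtain j where j: "j \<in> J" "E i j"
        by (auto simp: N_def)
      define S where "S = {K. K \<subseteq> I - {i} \<and> j \<in> N K}"
      define M where "M = insert (d i) (insert (s j) ((\<lambda>K. sum s (N K) - sum d K) ` S))"
      \<comment> \<open>The largest amount that leaves the demand at \<open>i\<close>, the supply at
        \<open>j\<close> and all slacks over \<open>S\<close> nonnegative. The minimum is attained,
        so one of these quantities drops to zero and \<open>reduce\<close> applies.\<close>
      define e where "e = Min M"
      have finS: "finite S" using fin by (simp add: S_def)
      have slack: "0 < sum s (N K) - sum d K" if "K \<in> S" for K
      proof -
        have "K \<subset> I" "K \<noteq> {}" using that i by (auto simp: S_def N_def)
        then have "sum d K \<noteq> sum s (N K)" "sum d K \<le> sum s (N K)" using irred Hs[of K] by blast+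
        then show ?thesis by simp
      qed
      have M: "finite M" "M \<noteq> {}" using finS by (simp_all add: M_def)
      have "0 < e"
        unfolding e_def Min_gr_iff[OF M] using pos i j slack by (auto simp: M_def)
      have e_le: "e \<le> d i" "e \<le> s j" "\<And>K. K \<in> S \<Longrightarrow> e \<le> sum s (N K) - sum d K"
        unfolding e_def by (rule Min_le[OF M(1)], simp add: M_def)+
      have e_cases: "e = d i \<or> e = s j \<or> (\<exists>K\<in>S. e = sum s (N K) - sum d K)"
        using Min_in[OF M] unfolding e_def[symmetric] by (auto simp: M_def)
      define d' where "d' = d(i := d i - e)"
      define s' where "s' = s(j := s j - e)"
      have sum_d': "sum d' K = sum d K - (if i \<in> K then e else 0)" if "K \<subseteq> I" for K
      proof -
        have "finite K" using that fin finite_subset by blast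
        then show ?thesis
          by (induction K) (auto simp: d'_def)
      qed
      have sum_s': "sum s' K = sum s K - (if j \<in> K then e else 0)" if "K \<subseteq> J" for K
      proof -
        have "finite K" using that fin finite_subset by blast
        then show ?thesis
          by (induction K) (auto simp: s'_def)
      qed
      have NJ: "N K \<subseteq> J" for K by (auto simp: N_def)
      have H': "hall I J d' s'"
        unfolding hall_def N_def[symmetric]
      proof (intro conjI ballI allI impI)
        fix K assume K: "K \<subseteq> I"
        show "sum d' K \<le> sum s' (N K)"
        proof (cases "i \<in> K")
          case True
          then show ?thesis
            using Hs[OF K] \<open>0 < e\<close> K NJ by (simp add: sum_d' sum_s')
        next
          case False
          have "K \<in> S" if "j \<in> N K" using K False that by (auto simp: S_def)
          then show ?thesis
            using Hs[OF K] e_le(3)[of K] K NJ False by (auto simp: sum_d' sum_s')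
        qed
      qed (use e_le pos in \<open>auto simp: d'_def s'_def intro: less_imp_le\<close>)
      have "sol I J d' s'"
      proof (rule reduce[OF H'])
        have "sum d' K = sum s' (N K)" if "K \<in> S" "e = sum s (N K) - sum d K" for K
        proof -
          have "K \<subseteq> I" "i \<notin> K" "j \<in> N K" using that by (auto simp: S_def)
          then show ?thesis using that NJ by (simp add: sum_d' sum_s')
        qed
        moreover have "K \<subset> I \<and> K \<noteq> {}" if "K \<in> S" for K
          using that i by (auto simp: S_def N_def)
        moreover have "e = d i \<Longrightarrow> d' i = 0" "e = s j \<Longrightarrow> s' j = 0"
          by (simp_all add: d'_def s'_def)
        ultimately show "(\<exists>i\<in>I. d' i = 0) \<or> (\<exists>j\<in>J. s' j = 0) \<or>
            (\<exists>K\<subset>I. K \<noteq> {} \<and> sum d' K = sum s' (N K))"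
          using e_cases i j(1) by blast
      qed
      then obtain t where t: "\<forall>i\<in>I. \<forall>j\<in>J. 0 \<le> t i j \<and> (t i j \<noteq> 0 \<longrightarrow> E i j)"
          "\<forall>i\<in>I. sum (t i) J = d' i" "\<forall>j\<in>J. (\<Sum>i\<in>I. t i j) \<le> s' j"
        unfolding sol_def by blast
      define v where "v k l = t k l + (if k = i \<and> l = j then e else 0)" for k l
      have "sum (v k) J = sum (t k) J + (if k = i then e else 0)" for k
        using fin j by (simp add: v_def sum.distrib)
      moreover have "(\<Sum>k\<in>I. v k l) = (\<Sum>k\<in>I. t k l) + (if l = j then e else 0)" for l
        using fin i by (cases "l = j") (simp_all add: v_def sum.distrib)
      ultimately show ?thesis
        using t \<open>0 < e\<close> j unfolding sol_def
        by (intro exI[of _ v]) (auto simp: v_def d'_def s'_def)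
    qed
  qed
  then show ?case unfolding sol_def .
qed

section \<open>Simple valuations\<close>

text \<open>This is the flattening of a simple valuation on \<open>Vf X\<close>, as
  \<open>Vf_mult_dirac_sum\<close> shows, and lets the algebra law be stated without an integral.
  Dirac sums, binary sums and scalar multiples are all instances.\<close>

definition val_combination :: "nat \<Rightarrow> (nat \<Rightarrow> real) \<Rightarrow> (nat \<Rightarrow> 'a set \<Rightarrow> ennreal) \<Rightarrow> 'a set \<Rightarrow> ennreal" where
  "val_combination n r M U = (\<Sum>i<n. ennreal (r i) * M i U)"

lemma val_combination_0: "val_combination 0 r M = (\<lambda>_. 0)"
  by (simp add: val_combination_def fun_eq_iff)

lemma val_combination_Suc:
  "val_combination (Suc n) r M = val_add (val_combination n r M) (val_scale (r n) (M n))"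
  by (simp add: val_combination_def val_add_def val_scale_def fun_eq_iff)

lemma dirac_sum_eq: "dirac_sum X n r x = val_combination n r (\<lambda>i. dirac X (x i))"
  by (simp add: dirac_sum_def val_combination_def fun_eq_iff)

lemma dirac_eq_dirac_sum: "dirac X x = dirac_sum X 1 (\<lambda>_. 1) (\<lambda>_. x)"
  by (simp add: dirac_sum_def fun_eq_iff)

lemma val_add_eq_combination: "val_add \<mu> \<nu> = val_combination 2 (\<lambda>_. 1) (\<lambda>i. if i = 0 then \<mu> else \<nu>)"
  by (simp add: val_combination_def val_add_def fun_eq_iff numeral_2_eq_2)

lemma val_scale_eq_combination: "val_scale r \<mu> = val_combination 1 (\<lambda>_. r) (\<lambda>_. \<mu>)"
  by (simp add: val_combination_def val_scale_def fun_eq_iff)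

text \<open>Simple valuations have finite masses on open sets, so the subbasic conditions become
  inequalities between real sums, the form in which Hall's condition is stated.\<close>

lemma dirac_sum_open:
  assumes "openin X U" "\<And>i. i < n \<Longrightarrow> 0 \<le> r i"
  shows "dirac_sum X n r x U = ennreal (sum r {i. i < n \<and> x i \<in> U})"
proof -
  have "dirac_sum X n r x U = (\<Sum>i<n. ennreal (if x i \<in> U then r i else 0))"
    using assms by (auto simp: dirac_sum_def dirac_def intro!: sum.cong)
  also have "\<dots> = ennreal (\<Sum>i<n. if x i \<in> U then r i else 0)"
    using assms by (intro sum_ennreal) auto
  also have "(\<Sum>i<n. if x i \<in> U then r i else 0) = sum r {i \<in> {..<n}. x i \<in> U}"
    by (intro sum.inter_filter[symmetric]) simp
  finally show ?thesis by simp
qed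

lemma val_scale_dirac_sum:
  "0 \<le> c \<Longrightarrow> val_scale c (dirac_sum X n r x) = dirac_sum X n (\<lambda>i. c * r i) x"
  by (simp add: val_scale_def dirac_sum_def fun_eq_iff sum_distrib_left ennreal_mult' mult.assoc)

lemma val_add_dirac_sum:
  "val_add (dirac_sum X n r x) (dirac_sum X m s y) =
     dirac_sum X (n + m) (\<lambda>i. if i < n then r i else s (i - n)) (\<lambda>i. if i < n then x i else y (i - n))"
proof
  show "val_add (dirac_sum X n r x) (dirac_sum X m s y) U =
      dirac_sum X (n + m) (\<lambda>i. if i < n then r i else s (i - n))
        (\<lambda>i. if i < n then x i else y (i - n)) U" for U
    by (induction m) (simp_all add: val_add_def dirac_sum_def flip: add.assoc)
qed

lemma simple_valuationsE:
  assumes "\<mu> \<in> simple_valuations X"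
  obtains n r x where "\<mu> = dirac_sum X n r x" "\<And>i. i < n \<Longrightarrow> 0 \<le> r i" "\<And>i. i < n \<Longrightarrow> x i \<in> topspace X"
  using assms by (auto simp: simple_valuations_def)

lemma dirac_sum_simple:
  "(\<And>i. i < n \<Longrightarrow> 0 \<le> r i) \<Longrightarrow> (\<And>i. i < n \<Longrightarrow> x i \<in> topspace X) \<Longrightarrow>
    dirac_sum X n r x \<in> simple_valuations X"
  unfolding simple_valuations_def by blast

lemma dirac_simple: "x \<in> topspace X \<Longrightarrow> dirac X x \<in> simple_valuations X"
  unfolding dirac_eq_dirac_sum by (rule dirac_sum_simple) auto

lemma zero_simple: "(\<lambda>_. 0) \<in> simple_valuations X"
  using dirac_sum_simple[of 0] by (simp add: dirac_sum_eq val_combination_0)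

lemma val_scale_simple:
  assumes "0 \<le> c" "\<mu> \<in> simple_valuations X"
  shows "val_scale c \<mu> \<in> simple_valuations X"
  using assms(2) by (rule simple_valuationsE) (use assms(1) in \<open>auto simp: val_scale_dirac_sum intro!: dirac_sum_simple\<close>)

lemma val_add_simple:
  assumes "\<mu> \<in> simple_valuations X" "\<nu> \<in> simple_valuations X"
  shows "val_add \<mu> \<nu> \<in> simple_valuations X"
proof -
  obtain n r x m s y where
    "\<mu> = dirac_sum X n r x" "\<And>i. i < n \<Longrightarrow> 0 \<le> r i" "\<And>i. i < n \<Longrightarrow> x i \<in> topspace X"
    "\<nu> = dirac_sum X m s y" "\<And>i. i < m \<Longrightarrow> 0 \<le> s i" "\<And>i. i < m \<Longrightarrow> y i \<in> topspace X"
    using assms by (elim simple_valuationsE) blast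
  then show ?thesis
    by (auto simp: val_add_dirac_sum intro!: dirac_sum_simple)
qed

lemma val_combination_simple:
  "(\<And>i. i < n \<Longrightarrow> 0 \<le> r i) \<Longrightarrow> (\<And>i. i < n \<Longrightarrow> M i \<in> simple_valuations X) \<Longrightarrow>
    val_combination n r M \<in> simple_valuations X"
  by (induction n)
    (simp_all add: val_combination_0 val_combination_Suc zero_simple val_add_simple val_scale_simple)

lemma simple_valuation_not_open: "\<mu> \<in> simple_valuations X \<Longrightarrow> \<not> openin X U \<Longrightarrow> \<mu> U = 0"
  by (auto simp: simple_valuations_def dirac_sum_def dirac_def)

section \<open>Continuous maps into the space of simple valuations\<close>

lemma openin_Vf_subbasic:
  "openin X U \<Longrightarrow> 0 \<le> r \<Longrightarrow> openin (Vf X) {\<mu> \<in> simple_valuations X. \<mu> U > ennreal r}"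
  unfolding Vf_def by (rule topology_generated_by_Basis) auto

lemma continuous_map_into_Vf:
  assumes "\<And>y. y \<in> topspace Y \<Longrightarrow> f y \<in> simple_valuations X"
    and "\<And>U r. openin X U \<Longrightarrow> 0 \<le> r \<Longrightarrow> openin Y {y \<in> topspace Y. f y U > ennreal r}"
  shows "continuous_map Y (Vf X) f"
  unfolding Vf_def
proof (rule continuous_on_generated_topo)
  fix W assume "W \<in> insert (simple_valuations X)
       {{\<mu> \<in> simple_valuations X. \<mu> U > ennreal r} | U r. openin X U \<and> 0 \<le> r}"
  then consider "W = simple_valuations X" |
    U r where "W = {\<mu> \<in> simple_valuations X. \<mu> U > ennreal r}" "openin X U" "0 \<le> r"
    by blast
  then show "openin Y (f -` W \<inter> topspace Y)"
  proof cases
    case 1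
    then have "f -` W \<inter> topspace Y = topspace Y" using assms(1) by auto
    then show ?thesis by simp
  next
    case 2
    then have "f -` W \<inter> topspace Y = {y \<in> topspace Y. f y U > ennreal r}" using assms(1) by auto
    then show ?thesis using assms(2) 2 by simp
  qed
qed (use assms(1) in auto)

lemma continuous_map_dirac: "continuous_map X (Vf X) (dirac X)"
proof (rule continuous_map_into_Vf)
  fix U r assume U: "openin X U" "0 \<le> (r::real)"
  have "{x \<in> topspace X. dirac X x U > ennreal r} = (if r < 1 then U else {})"
    using U openin_subset[OF U(1)] by (auto simp: dirac_def)
  then show "openin X {x \<in> topspace X. dirac X x U > ennreal r}"
    using U by simp
qed (rule dirac_simple)

lemma continuous_map_dirac_add:
  "continuous_map (prod_topology X X) (Vf X) (\<lambda>(x, y). val_add (dirac X x) (dirac X y))"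
proof (rule continuous_map_into_Vf)
  fix U and r :: real assume U: "openin X U" "0 \<le> r"
  show "openin (prod_topology X X) {p \<in> topspace (prod_topology X X).
      (case p of (x, y) \<Rightarrow> val_add (dirac X x) (dirac X y)) U > ennreal r}"
    unfolding openin_prod_topology_alt
  proof (intro allI impI)
    fix x y assume xy: "(x, y) \<in> {p \<in> topspace (prod_topology X X).
      (case p of (x, y) \<Rightarrow> val_add (dirac X x) (dirac X y)) U > ennreal r}"
    \<comment> \<open>The largest open set of points whose Dirac mass on \<open>U\<close> is at
      least that of \<open>z\<close>.\<close>
    define N where "N z = (if z \<in> U then U else topspace X)" for z
    have le: "dirac X z U \<le> dirac X w U" if "w \<in> N z" for z w
      using that by (auto simp: N_def dirac_def)
    have "ennreal r < dirac X x U + dirac X y U"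
      using xy by (simp add: val_add_def)
    then have "ennreal r < dirac X x' U + dirac X y' U" if "x' \<in> N x" "y' \<in> N y" for x' y'
      using add_mono[OF le[OF that(1)] le[OF that(2)]] by order
    moreover have "N z \<subseteq> topspace X" "openin X (N z)" for z
      using U openin_subset[OF U(1)] by (auto simp: N_def)
    moreover have "x \<in> N x" "y \<in> N y"
      using xy by (auto simp: N_def)
    ultimately show "\<exists>V W. openin X V \<and> openin X W \<and> x \<in> V \<and> y \<in> W \<and>
        V \<times> W \<subseteq> {p \<in> topspace (prod_topology X X).
          (case p of (x, y) \<Rightarrow> val_add (dirac X x) (dirac X y)) U > ennreal r}"
      by (intro exI[of _ "N x"] exI[of _ "N y"]) (auto simp: val_add_def)
  qed
qed (auto intro: val_add_simple dirac_simple)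

lemma continuous_map_dirac_scale:
  "continuous_map (prod_topology scott_nonneg X) (Vf X) (\<lambda>(r, x). val_scale r (dirac X x))"
proof (rule continuous_map_into_Vf)
  fix U and s :: real assume U: "openin X U" "0 \<le> s"
  \<comment> \<open>Since \<open>s\<close> is nonnegative, the strict inequality forces the point
    into \<open>U\<close>, where it says that the scalar exceeds \<open>s\<close>. The preimage is
    therefore an open rectangle.\<close>
  have "{p \<in> topspace (prod_topology scott_nonneg X).
      (case p of (r, x) \<Rightarrow> val_scale r (dirac X x)) U > ennreal s} = {s<..} \<times> U"
    using U openin_subset[OF U(1)] by (auto simp: val_scale_def dirac_def ennreal_less_iff split: if_splits)
  moreover have "openin scott_nonneg {s<..}"
    using U by (auto simp: openin_scott_nonneg)
  ultimately show "openin (prod_topology scott_nonneg X) {p \<in> topspace (prod_topology scott_nonneg X).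
      (case p of (r, x) \<Rightarrow> val_scale r (dirac X x)) U > ennreal s}"
    using U by (simp add: openin_prod_Times_iff)
qed (auto intro: val_scale_simple dirac_simple)

section \<open>Convex open sets of simple valuations\<close>

lemma cone_convex_Int:
  "cone_convex add smul A \<Longrightarrow> cone_convex add smul B \<Longrightarrow> cone_convex add smul (A \<inter> B)"
  by (simp add: cone_convex_def)

text \<open>Evaluation at \<open>U\<close> is linear, so the set is an open half-space.\<close>

lemma cone_convex_subbasic:
  "cone_convex val_add val_scale {\<mu> \<in> simple_valuations X. \<mu> U > ennreal r}"
  unfolding cone_convex_def
proof (intro ballI)
  fix \<mu> \<nu> and t :: real
  assume *: "\<mu> \<in> {\<mu> \<in> simple_valuations X. \<mu> U > ennreal r}"
    "\<nu> \<in> {\<mu> \<in> simple_valuations X. \<mu> U > ennreal r}" and t: "t \<in> {0..1}"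
  \<comment> \<open>Passing to the minimum puts the strict inequality first; the rest needs only
    weak monotonicity, so the weights 0 and 1 require no separate treatment.\<close>
  have "ennreal r < min (\<mu> U) (\<nu> U)"
    using * by simp
  also have "\<dots> = (ennreal t + ennreal (1 - t)) * min (\<mu> U) (\<nu> U)"
    using t by (simp flip: ennreal_plus)
  also have "\<dots> \<le> ennreal t * \<mu> U + ennreal (1 - t) * \<nu> U"
    unfolding distrib_right by (intro add_mono mult_left_mono) auto
  finally show "val_add (val_scale t \<mu>) (val_scale (1 - t) \<nu>) \<in>
      {\<mu> \<in> simple_valuations X. \<mu> U > ennreal r}"
    using * t by (auto simp: val_add_def val_scale_def[of _ _ U] intro!: val_add_simple val_scale_simple)
qed

text \<open>The generators are convex, and convexity survives intersections but not unions. The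
  induction over the generated opens therefore carries a claim about every point of the open
  set.\<close>

lemma Vf_locally_convex:
  assumes "openin (Vf X) W" "\<mu> \<in> W"
  obtains K where "openin (Vf X) K" "cone_convex val_add val_scale K" "\<mu> \<in> K" "K \<subseteq> W"
proof -
  have "\<forall>\<mu>\<in>W. \<exists>K. openin (Vf X) K \<and> cone_convex val_add val_scale K \<and> \<mu> \<in> K \<and> K \<subseteq> W"
    using openin_topology_generated_by[OF assms(1)[unfolded Vf_def]]
  proof induction
    case (Int V W)
    show ?case
    proof
      fix \<mu> assume "\<mu> \<in> V \<inter> W"
      then have "\<mu> \<in> V" "\<mu> \<in> W" by auto
      obtain K where K: "openin (Vf X) K" "cone_convex val_add val_scale K" "\<mu> \<in> K" "K \<subseteq> V"
        using bspec[OF Int.IH(1) \<open>\<mu> \<in> V\<close>] by auto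
      obtain L where L: "openin (Vf X) L" "cone_convex val_add val_scale L" "\<mu> \<in> L" "L \<subseteq> W"
        using bspec[OF Int.IH(2) \<open>\<mu> \<in> W\<close>] by auto
      from K L show "\<exists>K. openin (Vf X) K \<and> cone_convex val_add val_scale K \<and> \<mu> \<in> K \<and> K \<subseteq> V \<inter> W"
        by (intro exI[of _ "K \<inter> L"]) (auto intro!: cone_convex_Int)
    qed
  next
    case (UN \<W>)
    then show ?case by (meson Union_iff Union_upper subset_trans)
  next
    case (Basis W)
    then have "W = simple_valuations X \<or>
        (\<exists>U r. W = {\<mu> \<in> simple_valuations X. \<mu> U > ennreal r} \<and> openin X U \<and> 0 \<le> r)"
      by blast
    moreover have "openin (Vf X) (simple_valuations X)"
      using openin_topspace[of "Vf X"] by simp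
    moreover have "cone_convex val_add val_scale (simple_valuations X)"
      by (auto simp: cone_convex_def intro!: val_add_simple val_scale_simple)
    ultimately have "openin (Vf X) W" "cone_convex val_add val_scale W"
      by (auto simp: openin_Vf_subbasic cone_convex_subbasic)
    then show ?case by blast
  qed simp
  with assms(2) that show ?thesis by blast
qed

section \<open>The algebra laws on simple valuations\<close>

text \<open>Evaluation at an open \<open>U\<close> has open superlevel sets by the choice of the
  subbasis, so its integral is a finite sum. At other sets both sides vanish by the convention on
  valuations.\<close>

lemma Vf_mult_dirac_sum:
  assumes "\<And>i. i < n \<Longrightarrow> M i \<in> simple_valuations X"
  shows "Vf_mult X (dirac_sum (Vf X) n r M) = val_combination n r M"
proof
  fix U
  show "Vf_mult X (dirac_sum (Vf X) n r M) U = val_combination n r M U"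
  proof (cases "openin X U")
    case True
    then show ?thesis
      using assms by (simp add: Vf_mult_def val_combination_def val_integral_dirac_sum openin_Vf_subbasic)
  next
    case False
    then show ?thesis
      using assms by (simp add: Vf_mult_def val_combination_def simple_valuation_not_open[of _ X])
  qed
qed

text \<open>Continuity enters because \<open>dirac X\<close> tests the preimage of an open set for
  openness.\<close>

lemma Vf_map_dirac_sum:
  assumes "continuous_map X Y f" "\<And>i. i < n \<Longrightarrow> x i \<in> topspace X"
  shows "Vf_map X Y f (dirac_sum X n r x) = dirac_sum Y n r (\<lambda>i. f (x i))"
  using assms openin_continuous_map_preimage[OF assms(1)]
  by (auto simp: Vf_map_def dirac_sum_def dirac_def fun_eq_iff intro!: sum.cong)

text \<open>Elements of \<open>Vf (Vf X)\<close> are finite Dirac sums, on which the multiplication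
  law says that replacing each valuation in a combination by the Dirac mass at its image under
  \<alpha> does not change the result.\<close>

lemma Vf_algebra_iff:
  "Vf_algebra X \<alpha> \<longleftrightarrow>
     t0_space X \<and> continuous_map (Vf X) X \<alpha> \<and> (\<forall>x\<in>topspace X. \<alpha> (dirac X x) = x) \<and>
     (\<forall>n r M. (\<forall>i<n. 0 \<le> r i \<and> M i \<in> simple_valuations X) \<longrightarrow>
        \<alpha> (val_combination n r M) = \<alpha> (dirac_sum X n r (\<lambda>i. \<alpha> (M i))))"
proof -
  have "(\<forall>\<Phi>\<in>topspace (Vf (Vf X)). \<alpha> (Vf_mult X \<Phi>) = \<alpha> (Vf_map (Vf X) X \<alpha> \<Phi>)) \<longleftrightarrow>
      (\<forall>n r M. (\<forall>i<n. 0 \<le> r i \<and> M i \<in> simple_valuations X) \<longrightarrow>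
        \<alpha> (val_combination n r M) = \<alpha> (dirac_sum X n r (\<lambda>i. \<alpha> (M i))))"
    if cont: "continuous_map (Vf X) X \<alpha>"
  proof -
    have "\<alpha> (Vf_mult X (dirac_sum (Vf X) n r M)) = \<alpha> (val_combination n r M) \<and>
        \<alpha> (Vf_map (Vf X) X \<alpha> (dirac_sum (Vf X) n r M)) = \<alpha> (dirac_sum X n r (\<lambda>i. \<alpha> (M i)))"
      if "\<forall>i<n. 0 \<le> r i \<and> M i \<in> simple_valuations X" for n r M
      using that Vf_mult_dirac_sum[of n M X r] Vf_map_dirac_sum[OF cont, of n M r] by simp
    then show ?thesis
      unfolding topspace_Vf simple_valuations_def[of "Vf X"] by (smt (verit, best) mem_Collect_eq)
  qed
  then show ?thesis unfolding Vf_algebra_def by blast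
qed

section \<open>Algebras are weakly locally convex topological cones\<close>

locale simple_valuation_algebra =
  fixes X :: "'a topology" and \<alpha> :: "('a set \<Rightarrow> ennreal) \<Rightarrow> 'a"
  assumes algebra: "Vf_algebra X \<alpha>"
begin

definition alg_add :: "'a \<Rightarrow> 'a \<Rightarrow> 'a" where
  "alg_add x y = \<alpha> (val_add (dirac X x) (dirac X y))"

definition alg_smul :: "real \<Rightarrow> 'a \<Rightarrow> 'a" where
  "alg_smul r x = \<alpha> (val_scale r (dirac X x))"

lemma continuous_alpha: "continuous_map (Vf X) X \<alpha>"
  and alpha_dirac: "x \<in> topspace X \<Longrightarrow> \<alpha> (dirac X x) = x"
  and alpha_combination: "(\<And>i. i < n \<Longrightarrow> 0 \<le> r i) \<Longrightarrow> (\<And>i. i < n \<Longrightarrow> M i \<in> simple_valuations X) \<Longrightarrow>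
    \<alpha> (val_combination n r M) = \<alpha> (dirac_sum X n r (\<lambda>i. \<alpha> (M i)))"
  using algebra unfolding Vf_algebra_iff by blast+

lemma alpha_closed: "\<mu> \<in> simple_valuations X \<Longrightarrow> \<alpha> \<mu> \<in> topspace X"
  using continuous_map_funspace[OF continuous_alpha] by auto

text \<open>This is the multiplication law for two Dirac masses of weight 1. Together with
  \<open>alpha_scale\<close> it reduces each cone law to pointwise arithmetic of valuations, every
  point being the image of its Dirac mass.\<close>

lemma alpha_add:
  assumes "\<mu> \<in> simple_valuations X" "\<nu> \<in> simple_valuations X"
  shows "\<alpha> (val_add \<mu> \<nu>) = alg_add (\<alpha> \<mu>) (\<alpha> \<nu>)"
  unfolding val_add_eq_combination alg_add_def
  using assms by (subst alpha_combination) (auto simp: dirac_sum_eq intro!: arg_cong[of _ _ \<alpha>] arg_cong[of _ _ "val_combination 2 _"])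

lemma alpha_scale:
  assumes "0 \<le> r" "\<mu> \<in> simple_valuations X"
  shows "\<alpha> (val_scale r \<mu>) = alg_smul r (\<alpha> \<mu>)"
  unfolding val_scale_eq_combination alg_smul_def
  using assms by (subst alpha_combination) (auto simp: dirac_sum_eq)

lemma alg_add_commute: "alg_add x y = alg_add y x"
  unfolding alg_add_def by (intro arg_cong[of _ _ \<alpha>]) (simp add: val_add_def fun_eq_iff add.commute)

text \<open>The neutral element is the image of the zero valuation, that is, of the empty
  combination.\<close>

lemma cone: "abstract_cone (topspace X) alg_add (\<alpha> (\<lambda>_. 0)) alg_smul"
proof (rule abstract_cone.intro)
  note s = dirac_simple zero_simple val_add_simple val_scale_simple
  have A: "alg_add x y = \<alpha> (val_add (dirac X x) (dirac X y))"
    "alg_smul r x = \<alpha> (val_scale r (dirac X x))" for r x y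
    by (simp_all add: alg_add_def alg_smul_def)
  have assoc: "alg_add (alg_add x y) z = alg_add x (alg_add y z)"
    if "x \<in> topspace X" "y \<in> topspace X" "z \<in> topspace X" for x y z
  proof -
    have "alg_add (alg_add x y) z = \<alpha> (val_add (val_add (dirac X x) (dirac X y)) (dirac X z))"
      using that by (simp add: alpha_add alpha_dirac s)
    also have "\<dots> = \<alpha> (val_add (dirac X x) (val_add (dirac X y) (dirac X z)))"
      by (intro arg_cong[of _ _ \<alpha>]) (simp add: val_add_def fun_eq_iff add.assoc)
    also have "\<dots> = alg_add x (alg_add y z)"
      using that by (simp add: alpha_add alpha_dirac s)
    finally show ?thesis .
  qed
  have zero: "alg_add (\<alpha> (\<lambda>_. 0)) x = x" if "x \<in> topspace X" for x
  proof -
    have "alg_add (\<alpha> (\<lambda>_. 0)) x = \<alpha> (val_add (\<lambda>_. 0) (dirac X x))"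
      using that by (simp add: alpha_add alpha_dirac s)
    also have "val_add (\<lambda>_. 0) (dirac X x) = dirac X x"
      by (simp add: val_add_def fun_eq_iff)
    finally show ?thesis using that by (simp add: alpha_dirac)
  qed
  have closed: "alg_add x y \<in> topspace X" if "x \<in> topspace X" "y \<in> topspace X" for x y
    using that by (simp add: A alpha_closed s)
  show "Group.comm_monoid \<lparr>carrier = topspace X, monoid.mult = alg_add, one = \<alpha> (\<lambda>_. 0)\<rparr>"
    by (rule comm_monoidI)
      (use assoc zero closed alg_add_commute in \<open>auto intro: alpha_closed zero_simple\<close>)
  show "alg_smul r x \<in> topspace X" if "0 \<le> r" "x \<in> topspace X" for r x
    using that by (auto simp: A intro: alpha_closed s)
  show "alg_smul r (alg_add x y) = alg_add (alg_smul r x) (alg_smul r y)"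
    if "0 \<le> r" "x \<in> topspace X" "y \<in> topspace X" for r x y
  proof -
    have "alg_smul r (alg_add x y) = \<alpha> (val_scale r (val_add (dirac X x) (dirac X y)))"
      using that by (simp add: alpha_add alpha_scale alpha_dirac s)
    also have "\<dots> = \<alpha> (val_add (val_scale r (dirac X x)) (val_scale r (dirac X y)))"
      by (intro arg_cong[of _ _ \<alpha>]) (simp add: val_add_def val_scale_def fun_eq_iff distrib_left)
    also have "\<dots> = alg_add (alg_smul r x) (alg_smul r y)"
      using that by (simp add: alpha_add alpha_scale alpha_dirac s)
    finally show ?thesis .
  qed
  show "alg_smul (r + t) x = alg_add (alg_smul r x) (alg_smul t x)"
    if "0 \<le> r" "0 \<le> t" "x \<in> topspace X" for r t x
  proof -
    have "alg_smul (r + t) x = \<alpha> (val_add (val_scale r (dirac X x)) (val_scale t (dirac X x)))"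
      unfolding A using that
      by (intro arg_cong[of _ _ \<alpha>]) (simp add: val_add_def val_scale_def fun_eq_iff distrib_right)
    also have "\<dots> = alg_add (alg_smul r x) (alg_smul t x)"
      using that by (simp add: alpha_add alpha_scale alpha_dirac s)
    finally show ?thesis .
  qed
  show "alg_smul (r * t) x = alg_smul r (alg_smul t x)"
    if "0 \<le> r" "0 \<le> t" "x \<in> topspace X" for r t x
  proof -
    have "alg_smul (r * t) x = \<alpha> (val_scale r (val_scale t (dirac X x)))"
      unfolding A using that
      by (intro arg_cong[of _ _ \<alpha>]) (simp add: val_scale_def fun_eq_iff ennreal_mult mult.assoc)
    also have "\<dots> = alg_smul r (alg_smul t x)"
      using that by (simp add: alpha_scale alpha_dirac s)
    finally show ?thesis .
  qed
  show "alg_smul 1 x = x" if "x \<in> topspace X" for x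
  proof -
    have "val_scale 1 (dirac X x) = dirac X x" by (simp add: val_scale_def fun_eq_iff)
    then show ?thesis using that by (simp add: A alpha_dirac)
  qed
  show "alg_smul 0 x = \<alpha> (\<lambda>_. 0)" if "x \<in> topspace X" for x
    unfolding A by (intro arg_cong[of _ _ \<alpha>]) (simp add: val_scale_def fun_eq_iff)
  show "alg_smul r (\<alpha> (\<lambda>_. 0)) = \<alpha> (\<lambda>_. 0)" if "0 \<le> r" for r
  proof -
    have "val_scale r (\<lambda>_. 0) = (\<lambda>_::'a set. 0)" by (simp add: val_scale_def fun_eq_iff)
    then show ?thesis using alpha_scale[OF that zero_simple] by simp
  qed
qed

lemma topological: "topological_cone X alg_add (\<alpha> (\<lambda>_. 0)) alg_smul"
proof (intro topological_cone.intro cone topological_cone_axioms.intro)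
  show "t0_space X"
    using algebra by (simp add: Vf_algebra_def)
  show "continuous_map (prod_topology X X) X (\<lambda>(x, y). alg_add x y)"
    using continuous_map_compose[OF continuous_map_dirac_add continuous_alpha]
    by (simp add: comp_def alg_add_def case_prod_unfold)
  show "continuous_map (prod_topology scott_nonneg X) X (\<lambda>(r, x). alg_smul r x)"
    using continuous_map_compose[OF continuous_map_dirac_scale continuous_alpha]
    by (simp add: comp_def alg_smul_def case_prod_unfold)
qed

text \<open>Local convexity passes from \<open>Vf X\<close> to its retract \<open>X\<close>: the image of a convex open set under
  \<open>\<alpha>\<close> is convex, and it contains the open preimage of that set under \<open>dirac X\<close>.\<close>

lemma weakly_locally_convex: "neighbourhood_base_of (cone_convex alg_add alg_smul) X"
  unfolding neighbourhood_base_of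
proof (intro allI impI)
  fix W x assume W: "openin X W \<and> x \<in> W"
  then have x: "x \<in> topspace X" using openin_subset by blast
  define V where "V = {\<mu> \<in> simple_valuations X. \<alpha> \<mu> \<in> W}"
  have "openin (Vf X) V"
    using openin_continuous_map_preimage[OF continuous_alpha, of W] W by (simp add: V_def)
  moreover have "dirac X x \<in> V"
    using W x by (simp add: V_def dirac_simple alpha_dirac)
  ultimately obtain K where K: "openin (Vf X) K" "cone_convex val_add val_scale K" "dirac X x \<in> K" "K \<subseteq> V"
    by (rule Vf_locally_convex)
  have KX: "K \<subseteq> simple_valuations X" using K(4) by (auto simp: V_def)
  define N where "N = {y \<in> topspace X. dirac X y \<in> K}"
  have "openin X N"
    using openin_continuous_map_preimage[OF continuous_map_dirac K(1)] by (simp add: N_def)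
  moreover have "x \<in> N" using x K by (simp add: N_def)
  \<comment> \<open>Each \<open>y\<close> in \<open>N\<close> is the image of its own Dirac mass.
    Nothing makes the image of the open set \<open>K\<close> open, so only the weak form of local
    convexity results.\<close>
  moreover have "N \<subseteq> \<alpha> ` K"
    by (auto simp: N_def image_iff) (metis alpha_dirac)
  moreover have "\<alpha> ` K \<subseteq> W" using K(4) by (auto simp: V_def)
  moreover have "cone_convex alg_add alg_smul (\<alpha> ` K)"
    unfolding cone_convex_def
  proof (intro ballI)
    fix a b and t :: real assume "a \<in> \<alpha> ` K" "b \<in> \<alpha> ` K" and t: "t \<in> {0..1}"
    then obtain \<mu> \<nu> where \<mu>\<nu>: "\<mu> \<in> K" "\<nu> \<in> K" "a = \<alpha> \<mu>" "b = \<alpha> \<nu>" by blast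
    then have "val_add (val_scale t \<mu>) (val_scale (1 - t) \<nu>) \<in> K"
      using K(2) t by (auto simp: cone_convex_def)
    moreover have "\<alpha> (val_add (val_scale t \<mu>) (val_scale (1 - t) \<nu>)) =
        alg_add (alg_smul t a) (alg_smul (1 - t) b)"
      using \<mu>\<nu> t subsetD[OF KX] by (subst alpha_add) (simp_all add: alpha_scale val_scale_simple)
    ultimately show "alg_add (alg_smul t a) (alg_smul (1 - t) b) \<in> \<alpha> ` K"
      by (metis imageI)
  qed
  ultimately show "\<exists>U V. openin X U \<and> cone_convex alg_add alg_smul V \<and> x \<in> U \<and> U \<subseteq> V \<and> V \<subseteq> W"
    by blast
qed

lemma barycentre_map: "is_barycentre_map X alg_add (\<alpha> (\<lambda>_. 0)) alg_smul \<alpha>"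
  unfolding is_barycentre_map_def
proof (intro allI impI)
  interpret abstract_cone "topspace X" alg_add "\<alpha> (\<lambda>_. 0)" alg_smul by (rule cone)
  interpret G: Group.comm_monoid "\<lparr>carrier = topspace X, monoid.mult = alg_add, one = \<alpha> (\<lambda>_. 0)\<rparr>"
    by (rule add_monoid)
  fix n and r :: "nat \<Rightarrow> real" and x assume "\<forall>i<n. 0 \<le> r i \<and> x i \<in> topspace X"
  then show "\<alpha> (dirac_sum X n r x) =
      cone_combination (topspace X) alg_add (\<alpha> (\<lambda>_. 0)) alg_smul n r x"
  proof (induction n)
    case 0
    then show ?case by (simp add: dirac_sum_eq val_combination_0 cone_combination_def)
  next
    case (Suc n)
    have "dirac_sum X n r x \<in> simple_valuations X"
      using Suc.prems by (intro dirac_sum_simple) auto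
    then have "\<alpha> (dirac_sum X (Suc n) r x) = alg_add (\<alpha> (dirac_sum X n r x)) (alg_smul (r n) (x n))"
      using Suc.prems
      by (simp add: dirac_sum_eq val_combination_Suc alpha_add alpha_scale alpha_dirac val_scale_simple dirac_simple)
    \<comment> \<open>The new term comes first in \<open>finprod_insert\<close> but last in
      \<open>val_combination_Suc\<close>.\<close>
    also have "\<dots> = alg_add (alg_smul (r n) (x n)) (cone_combination (topspace X) alg_add (\<alpha> (\<lambda>_. 0)) alg_smul n r x)"
      using Suc by (simp add: alg_add_commute)
    also have "\<dots> = cone_combination (topspace X) alg_add (\<alpha> (\<lambda>_. 0)) alg_smul (Suc n) r x"
      unfolding cone_combination_def lessThan_Suc
      using Suc.prems by (subst G.finprod_insert) (auto intro: smul_closed)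
    finally show ?case .
  qed
qed

lemma weakly_locally_convex_cone:
  "weakly_locally_convex_topological_cone X alg_add (\<alpha> (\<lambda>_. 0)) alg_smul"
  by (intro weakly_locally_convex_topological_cone.intro topological weakly_locally_convex
      weakly_locally_convex_topological_cone_axioms.intro)

end

section \<open>Finite sums in cones\<close>

context abstract_cone
begin

sublocale additive: Group.comm_monoid "\<lparr>carrier = C, monoid.mult = add, one = zero\<rparr>"
  by (rule add_monoid)

text \<open>General index sets are required: the continuity argument drops the indices of weight
  zero and exchanges a double sum. \<open>cone_combination\<close> is the case of an initial
  segment.\<close>

definition csum :: "('b \<Rightarrow> 'a) \<Rightarrow> 'b set \<Rightarrow> 'a" where
  "csum f A = finprod \<lparr>carrier = C, monoid.mult = add, one = zero\<rparr> f A"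

lemma add_closed: "x \<in> C \<Longrightarrow> y \<in> C \<Longrightarrow> add x y \<in> C"
  and zero_closed: "zero \<in> C"
  and add_assoc: "x \<in> C \<Longrightarrow> y \<in> C \<Longrightarrow> z \<in> C \<Longrightarrow> add (add x y) z = add x (add y z)"
  and add_commute: "x \<in> C \<Longrightarrow> y \<in> C \<Longrightarrow> add x y = add y x"
  and add_zero_left: "x \<in> C \<Longrightarrow> add zero x = x"
  and add_zero_right: "x \<in> C \<Longrightarrow> add x zero = x"
  using additive.m_closed additive.one_closed additive.m_assoc additive.m_comm additive.l_one
    additive.r_one by simp_all

lemma csum_empty: "csum f {} = zero"
  by (simp add: csum_def)

lemma csum_insert:
  "finite A \<Longrightarrow> i \<notin> A \<Longrightarrow> (\<And>j. j \<in> insert i A \<Longrightarrow> f j \<in> C) \<Longrightarrow> csum f (insert i A) = add (f i) (csum f A)"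
  unfolding csum_def by (subst additive.finprod_insert) auto

lemma csum_closed: "(\<And>j. j \<in> A \<Longrightarrow> f j \<in> C) \<Longrightarrow> csum f A \<in> C"
  using additive.finprod_closed[of f A] by (auto simp: csum_def)

lemma csum_cong: "(\<And>j. j \<in> A \<Longrightarrow> g j \<in> C) \<Longrightarrow> (\<And>j. j \<in> A \<Longrightarrow> f j = g j) \<Longrightarrow> csum f A = csum g A"
  unfolding csum_def by (rule additive.finprod_cong') auto

lemma csum_add:
  "(\<And>j. j \<in> A \<Longrightarrow> f j \<in> C) \<Longrightarrow> (\<And>j. j \<in> A \<Longrightarrow> g j \<in> C) \<Longrightarrow>
    csum (\<lambda>j. add (f j) (g j)) A = add (csum f A) (csum g A)"
  using additive.finprod_multf[of f A g] by (auto simp: csum_def)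

lemma csum_neutral_subset:
  assumes "finite B" "A \<subseteq> B" "\<And>j. j \<in> B - A \<Longrightarrow> f j = zero" "\<And>j. j \<in> B \<Longrightarrow> f j \<in> C"
  shows "csum f B = csum f A"
  unfolding csum_def using assms by (intro additive.finprod_mono_neutral_cong_right) auto

lemma csum_zero: "csum (\<lambda>_. zero) A = zero"
  using additive.finprod_one[of A] by (simp add: csum_def)

lemma csum_swap:
  assumes "finite I" "finite J" "\<And>i j. i \<in> I \<Longrightarrow> j \<in> J \<Longrightarrow> f i j \<in> C"
  shows "csum (\<lambda>j. csum (\<lambda>i. f i j) I) J = csum (\<lambda>i. csum (f i) J) I"
  using assms
proof (induction I)
  case empty
  then show ?case by (simp add: csum_empty csum_zero)
next
  case (insert k I)
  have "csum (\<lambda>j. csum (\<lambda>i. f i j) (insert k I)) J = csum (\<lambda>j. add (f k j) (csum (\<lambda>i. f i j) I)) J"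
    using insert.prems insert.hyps by (intro csum_cong csum_insert) (auto intro!: add_closed csum_closed)
  also have "\<dots> = add (csum (f k) J) (csum (\<lambda>j. csum (\<lambda>i. f i j) I) J)"
    using insert.prems by (intro csum_add csum_closed) auto
  also have "\<dots> = add (csum (f k) J) (csum (\<lambda>i. csum (f i) J) I)"
    using insert by simp
  also have "\<dots> = csum (\<lambda>i. csum (f i) J) (insert k I)"
    using insert.prems insert.hyps by (intro csum_insert[symmetric]) (auto intro!: csum_closed)
  finally show ?case .
qed

lemma csum_smul_left:
  assumes "finite A" "\<And>i. i \<in> A \<Longrightarrow> 0 \<le> t i" "y \<in> C"
  shows "csum (\<lambda>i. smul (t i) y) A = smul (sum t A) y"
  using assms
proof (induction A)
  case empty
  then show ?case by (simp add: csum_empty smul_zero_left)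
next
  case (insert k A)
  then have "csum (\<lambda>i. smul (t i) y) (insert k A) = add (smul (t k) y) (csum (\<lambda>i. smul (t i) y) A)"
    by (intro csum_insert smul_closed) auto
  with insert show ?case by (simp add: smul_add_left sum_nonneg)
qed

lemma smul_csum:
  assumes "finite A" "\<And>i. i \<in> A \<Longrightarrow> f i \<in> C" "0 \<le> c"
  shows "smul c (csum f A) = csum (\<lambda>i. smul c (f i)) A"
  using assms
proof (induction A)
  case empty
  then show ?case by (simp add: csum_empty smul_zero_right)
next
  case (insert k A)
  then have "csum f (insert k A) = add (f k) (csum f A)"
    "csum (\<lambda>i. smul c (f i)) (insert k A) = add (smul c (f k)) (csum (\<lambda>i. smul c (f i)) A)"
    by (intro csum_insert smul_closed; simp)+
  with insert show ?case by (simp add: smul_add_right csum_closed)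
qed

text \<open>Dividing by the total weight turns the sum into a multiple of a convex combination. The
  total is left arbitrary because it will be one of the coefficients \<open>d i\<close>.\<close>

lemma csum_convex:
  assumes "cone_convex add smul A" "A \<subseteq> C"
    and "finite J" "\<And>j. j \<in> J \<Longrightarrow> 0 \<le> t j" "\<And>j. j \<in> J \<Longrightarrow> y j \<in> A" "0 < sum t J"
  shows "\<exists>a\<in>A. csum (\<lambda>j. smul (t j) (y j)) J = smul (sum t J) a"
  using assms(3-)
proof (induction J)
  case empty
  then show ?case by simp
next
  case (insert k J)
  define T where "T = sum t J"
  have yC: "\<And>j. j \<in> insert k J \<Longrightarrow> y j \<in> C" using insert.prems(2) assms(2) by blast
  have T0: "0 \<le> T" unfolding T_def using insert.prems(1) by (intro sum_nonneg) auto
  have sum: "sum t (insert k J) = t k + T" using insert.hyps by (simp add: T_def)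
  have csum: "csum (\<lambda>j. smul (t j) (y j)) (insert k J) =
      add (smul (t k) (y k)) (csum (\<lambda>j. smul (t j) (y j)) J)"
    using insert.hyps insert.prems(1) yC by (intro csum_insert smul_closed) auto
  show ?case
  proof (cases "T = 0")
    \<comment> \<open>All other weights vanish, and \<open>y k\<close> itself is the required
      point.\<close>
    case True
    then have "\<And>j. j \<in> J \<Longrightarrow> t j = 0"
      using insert.hyps insert.prems(1) by (simp add: T_def sum_nonneg_eq_0_iff)
    then have "csum (\<lambda>j. smul (t j) (y j)) J = csum (\<lambda>_. zero) J"
      using yC by (intro csum_cong) (auto simp: smul_zero_left zero_closed)
    then show ?thesis
      using True insert.prems yC unfolding csum sum
      by (intro bexI[of _ "y k"]) (auto simp: csum_zero add_zero_right smul_closed)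
  next
    case False
    with T0 have T: "0 < T" by simp
    with insert obtain a where a: "a \<in> A" "csum (\<lambda>j. smul (t j) (y j)) J = smul T a"
      unfolding T_def by auto
    have tk: "0 \<le> t k" "y k \<in> A" "y k \<in> C" "a \<in> C" using insert.prems yC a assms(2) by auto
    define S where "S = t k + T"
    \<comment> \<open>The share of \<open>k\<close> in the total weight; the point \<open>a\<close>
      obtained for \<open>J\<close> receives the rest.\<close>
    define p where "p = t k / S"
    have S: "0 < S" using T tk by (simp add: S_def)
    have p: "0 \<le> p" "p \<le> 1" "S * p = t k" "S * (1 - p) = T"
      using S T tk by (auto simp: p_def S_def field_simps)
    have "add (smul p (y k)) (smul (1 - p) a) \<in> A"
      using assms(1) a tk p by (auto simp: cone_convex_def)
    moreover have "smul S (add (smul p (y k)) (smul (1 - p) a)) = add (smul (t k) (y k)) (smul T a)"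
      using S p tk by (simp add: smul_add_right smul_closed flip: smul_smul)
    ultimately show ?thesis
      unfolding csum sum a(2) S_def[symmetric] by metis
  qed
qed

section \<open>Linear combinations of finite families of points\<close>

abbreviation combination :: "nat \<Rightarrow> (nat \<Rightarrow> real) \<Rightarrow> (nat \<Rightarrow> 'a) \<Rightarrow> 'a" where
  "combination \<equiv> cone_combination C add zero smul"

lemma combination_eq_csum: "combination n r x = csum (\<lambda>i. smul (r i) (x i)) {..<n}"
  by (simp add: cone_combination_def csum_def)

lemma combination_closed:
  "(\<And>i. i < n \<Longrightarrow> 0 \<le> r i) \<Longrightarrow> (\<And>i. i < n \<Longrightarrow> x i \<in> C) \<Longrightarrow> combination n r x \<in> C"
  unfolding combination_eq_csum by (intro csum_closed smul_closed) auto

lemma combination_0: "combination 0 r x = zero"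
  by (simp add: combination_eq_csum csum_empty)

lemma combination_Suc:
  assumes "\<And>i. i < Suc n \<Longrightarrow> 0 \<le> r i" "\<And>i. i < Suc n \<Longrightarrow> x i \<in> C"
  shows "combination (Suc n) r x = add (combination n r x) (smul (r n) (x n))"
proof -
  have "combination (Suc n) r x = add (smul (r n) (x n)) (combination n r x)"
    unfolding combination_eq_csum lessThan_Suc using assms by (intro csum_insert smul_closed) auto
  also have "\<dots> = add (combination n r x) (smul (r n) (x n))"
    using assms by (intro add_commute combination_closed smul_closed) auto
  finally show ?thesis .
qed

lemma smul_combination:
  assumes "\<And>i. i < n \<Longrightarrow> 0 \<le> r i" "\<And>i. i < n \<Longrightarrow> x i \<in> C" "0 \<le> c"
  shows "smul c (combination n r x) = combination n (\<lambda>i. c * r i) x"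
  unfolding combination_eq_csum using assms
  by (subst smul_csum) (auto simp: smul_closed smul_smul intro!: csum_cong)

text \<open>The concatenated families are those of \<open>val_add_dirac_sum\<close>, so additivity
  of barycentres follows by rewriting.\<close>

lemma add_combination:
  assumes "\<And>i. i < n \<Longrightarrow> 0 \<le> r i" "\<And>i. i < n \<Longrightarrow> x i \<in> C"
    and "\<And>i. i < m \<Longrightarrow> 0 \<le> s i" "\<And>i. i < m \<Longrightarrow> y i \<in> C"
  shows "add (combination n r x) (combination m s y) =
    combination (n + m) (\<lambda>i. if i < n then r i else s (i - n)) (\<lambda>i. if i < n then x i else y (i - n))"
  using assms(3,4)
proof (induction m)
  case 0
  have "combination n (\<lambda>i. if i < n then r i else s (i - n)) (\<lambda>i. if i < n then x i else y (i - n)) =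
      combination n r x"
    unfolding combination_eq_csum using assms(1,2) by (intro csum_cong) (auto intro: smul_closed)
  then show ?case
    using assms(1,2) by (simp add: combination_0 add_zero_right combination_closed)
next
  case (Suc m)
  have "add (combination n r x) (combination (Suc m) s y) =
      add (add (combination n r x) (combination m s y)) (smul (s m) (y m))"
    using assms(1,2) Suc.prems
    by (subst combination_Suc) (auto simp: add_assoc combination_closed smul_closed)
  also have "\<dots> = combination (n + Suc m) (\<lambda>i. if i < n then r i else s (i - n)) (\<lambda>i. if i < n then x i else y (i - n))"
    using assms(1,2) Suc by (simp add: combination_Suc)
  finally show ?case .
qed

end

section \<open>The specialization order of a topological cone\<close>

lemma continuous_map_prod_nbhd:
  assumes "continuous_map (prod_topology Y Z) X (\<lambda>(x, y). f x y)" "openin X U"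
    and "x \<in> topspace Y" "y \<in> topspace Z" "f x y \<in> U"
  obtains V W where "openin Y V" "openin Z W" "x \<in> V" "y \<in> W"
    "\<And>a b. a \<in> V \<Longrightarrow> b \<in> W \<Longrightarrow> f a b \<in> U"
proof -
  define S where "S = {p \<in> topspace (prod_topology Y Z). (case p of (x, y) \<Rightarrow> f x y) \<in> U}"
  have "openin (prod_topology Y Z) S"
    unfolding S_def using openin_continuous_map_preimage[OF assms(1,2)] .
  moreover have "(x, y) \<in> S"
    using assms by (simp add: S_def)
  ultimately obtain V W where VW: "openin Y V" "openin Z W" "x \<in> V" "y \<in> W" "V \<times> W \<subseteq> S"
    unfolding openin_prod_topology_alt by meson
  have "f a b \<in> U" if "a \<in> V" "b \<in> W" for a b
    using subsetD[OF VW(5), of "(a, b)"] that by (simp add: S_def)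
  with VW(1-4) show thesis by (rule that)
qed

context topological_cone
begin

definition below :: "'a \<Rightarrow> 'a \<Rightarrow> bool" where
  "below x y \<longleftrightarrow> (\<forall>U. openin X U \<and> x \<in> U \<longrightarrow> y \<in> U)"

lemmas add_nbhd = continuous_map_prod_nbhd[OF continuous_add]
  and smul_nbhd = continuous_map_prod_nbhd[OF continuous_smul]

text \<open>The only Scott-open set containing \<open>0\<close> is \<open>{0..}\<close>.\<close>

lemma zero_below:
  assumes "x \<in> topspace X"
  shows "below zero x"
  unfolding below_def
proof (intro allI impI)
  fix U assume U: "openin X U \<and> zero \<in> U"
  then obtain R V where "openin scott_nonneg R" "openin X V" "0 \<in> R" "x \<in> V"
      and *: "\<And>t a. t \<in> R \<Longrightarrow> a \<in> V \<Longrightarrow> smul t a \<in> U"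
    using assms by (elim conjE smul_nbhd[of U 0 x]) (auto simp: smul_zero_left)
  then have "1 \<in> R" by (auto simp: openin_scott_nonneg)
  with *[OF this \<open>x \<in> V\<close>] show "x \<in> U" using assms by (simp add: smul_one)
qed

lemma add_below_mono:
  assumes "x \<in> topspace X" "x' \<in> topspace X" "y \<in> topspace X" "y' \<in> topspace X" "below x x'" "below y y'"
  shows "below (add x y) (add x' y')"
  unfolding below_def
proof (intro allI impI)
  fix U assume U: "openin X U \<and> add x y \<in> U"
  then obtain V W where "openin X V" "openin X W" "x \<in> V" "y \<in> W"
      and *: "\<And>a b. a \<in> V \<Longrightarrow> b \<in> W \<Longrightarrow> add a b \<in> U"
    using assms by (elim conjE add_nbhd[of U x y]) auto
  with assms(5,6) show "add x' y' \<in> U"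
    by (intro *) (auto simp: below_def)
qed

text \<open>The larger multiple is the smaller one plus a term that lies above zero.\<close>

lemma smul_below_mono:
  assumes "0 \<le> r" "r \<le> t" "x \<in> topspace X"
  shows "below (smul r x) (smul t x)"
proof -
  have "below (add (smul r x) zero) (add (smul r x) (smul (t - r) x))"
    using assms by (intro add_below_mono zero_below smul_closed zero_closed) (auto simp: below_def)
  then show ?thesis
    using assms smul_add_left[of r "t - r" x] by (simp add: add_zero_right smul_closed)
qed

lemma csum_below_mono:
  assumes "finite A" "\<And>i. i \<in> A \<Longrightarrow> f i \<in> topspace X" "\<And>i. i \<in> A \<Longrightarrow> g i \<in> topspace X"
    "\<And>i. i \<in> A \<Longrightarrow> below (f i) (g i)"
  shows "below (csum f A) (csum g A)"
  using assms
proof (induction A)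
  case empty
  then show ?case by (simp add: csum_empty below_def)
next
  case (insert i A)
  then show ?case
    by (subst (1 2) csum_insert) (auto intro!: add_below_mono csum_closed)
qed

text \<open>This is joint continuity of a finite linear combination, with the Scott neighbourhood of
  each coefficient \<open>r i\<close> reduced to one smaller element \<open>d i\<close>. The gap
  between the two later absorbs the strict inequalities of the subbasic sets.\<close>

lemma csum_nbhd:
  fixes r :: "'b \<Rightarrow> real"
  assumes "finite I" "\<And>i. i \<in> I \<Longrightarrow> 0 < r i" "\<And>i. i \<in> I \<Longrightarrow> x i \<in> topspace X"
    and "openin X U" "csum (\<lambda>i. smul (r i) (x i)) I \<in> U"
  shows "\<exists>d V. (\<forall>i\<in>I. 0 < d i \<and> d i < r i \<and> openin X (V i) \<and> x i \<in> V i) \<and>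
    (\<forall>a. (\<forall>i\<in>I. a i \<in> V i) \<longrightarrow> csum (\<lambda>i. smul (d i) (a i)) I \<in> U)"
  using assms
proof (induction I arbitrary: U)
  case empty
  then show ?case by (simp add: csum_empty)
next
  case (insert k I)
  have "csum (\<lambda>i. smul (r i) (x i)) (insert k I) =
      add (smul (r k) (x k)) (csum (\<lambda>i. smul (r i) (x i)) I)"
    using insert.hyps insert.prems by (intro csum_insert smul_closed) (auto intro: less_imp_le)
  then have "add (smul (r k) (x k)) (csum (\<lambda>i. smul (r i) (x i)) I) \<in> U"
    using insert.prems by simp
  then obtain P Q where PQ: "openin X P" "openin X Q" "smul (r k) (x k) \<in> P"
      "csum (\<lambda>i. smul (r i) (x i)) I \<in> Q" "\<And>a b. a \<in> P \<Longrightarrow> b \<in> Q \<Longrightarrow> add a b \<in> U"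
    using insert.prems
    by (elim add_nbhd[OF insert.prems(3), rotated 2]) (auto intro!: smul_closed csum_closed less_imp_le)
  obtain d V where dV: "\<forall>i\<in>I. 0 < d i \<and> d i < r i \<and> openin X (V i) \<and> x i \<in> V i"
      "\<forall>a. (\<forall>i\<in>I. a i \<in> V i) \<longrightarrow> csum (\<lambda>i. smul (d i) (a i)) I \<in> Q"
    using insert.IH[of Q] insert.prems PQ by auto
  obtain R W where RW: "openin scott_nonneg R" "openin X W" "r k \<in> R" "x k \<in> W"
      "\<And>t a. t \<in> R \<Longrightarrow> a \<in> W \<Longrightarrow> smul t a \<in> P"
    using insert.prems PQ(3) by (elim smul_nbhd[OF PQ(1), rotated 2]) (auto intro: less_imp_le)
  \<comment> \<open>A Scott-open set containing a positive number also contains a smaller positive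
    one: half of it, or its midpoint with the bound \<open>q\<close>.\<close>
  obtain e where e: "0 < e" "e < r k" "e \<in> R"
  proof -
    have rk: "0 < r k" using insert.prems by simp
    consider "R = {0..}" | q where "0 \<le> q" "R = {q<..}"
      using RW by (auto simp: openin_scott_nonneg)
    then show ?thesis
    proof cases
      case 1
      then show ?thesis using that[of "r k / 2"] rk by simp
    next
      case 2
      then show ?thesis using that[of "(q + r k) / 2"] rk RW by simp
    qed
  qed
  show ?case
  proof (intro exI[of _ "d(k := e)"] exI[of _ "V(k := W)"] conjI ballI allI impI)
    fix a assume a: "\<forall>i\<in>insert k I. a i \<in> (V(k := W)) i"
    then have aI: "\<forall>i\<in>I. a i \<in> V i" "a k \<in> W"
      using insert.hyps by (auto split: if_splits)
    have aX: "\<And>i. i \<in> insert k I \<Longrightarrow> a i \<in> topspace X"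
      using aI dV RW openin_subset by blast
    have "csum (\<lambda>i. smul ((d(k := e)) i) (a i)) (insert k I) =
        add (smul e (a k)) (csum (\<lambda>i. smul ((d(k := e)) i) (a i)) I)"
      using insert.hyps e dV aX by (subst csum_insert) (auto intro!: smul_closed less_imp_le)
    also have "csum (\<lambda>i. smul ((d(k := e)) i) (a i)) I = csum (\<lambda>i. smul (d i) (a i)) I"
      using insert.hyps dV aX by (intro csum_cong) (auto intro!: smul_closed less_imp_le)
    also have "add (smul e (a k)) \<dots> \<in> U"
      using PQ(5) RW(5) dV(2) e aI by blast
    finally show "csum (\<lambda>i. smul ((d(k := e)) i) (a i)) (insert k I) \<in> U" .
  qed (use insert.hyps dV RW e in auto)
qed

end

section \<open>The barycentre map of a weakly locally convex topological cone\<close>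

context weakly_locally_convex_topological_cone
begin

text \<open>Besides the continuity of barycentres, this gives their well-definedness: two
  representations of the same valuation have barycentres in the same open sets, and the space is
  \<open>T\<^sub>0\<close>.\<close>

lemma combination_nbhd:
  assumes "openin X U" "\<And>i. i < n \<Longrightarrow> 0 \<le> r i" "\<And>i. i < n \<Longrightarrow> x i \<in> topspace X"
    and "combination n r x \<in> U"
  shows "\<exists>W. openin (Vf X) W \<and> dirac_sum X n r x \<in> W \<and>
    (\<forall>m s y. (\<forall>j<m. 0 \<le> s j \<and> y j \<in> topspace X) \<and> dirac_sum X m s y \<in> W \<longrightarrow> combination m s y \<in> U)"
proof -
  \<comment> \<open>\<open>csum_nbhd\<close> needs room below each coefficient, so zero coefficients
    are dropped.\<close>
  define I where "I = {i. i < n \<and> 0 < r i}"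
  have I: "finite I" "\<And>i. i \<in> I \<Longrightarrow> 0 < r i" "\<And>i. i \<in> I \<Longrightarrow> x i \<in> topspace X"
    using assms(3) by (auto simp: I_def)
  have "combination n r x = csum (\<lambda>i. smul (r i) (x i)) I"
    unfolding combination_eq_csum
  proof (rule csum_neutral_subset)
    fix i assume "i \<in> {..<n} - I"
    then have "r i = 0" "x i \<in> topspace X"
      using assms(2)[of i] assms(3)[of i] by (auto simp: I_def)
    then show "smul (r i) (x i) = zero" by (simp add: smul_zero_left)
  qed (use assms in \<open>auto simp: I_def intro: smul_closed\<close>)
  then obtain d V where dV: "\<forall>i\<in>I. 0 < d i \<and> d i < r i \<and> openin X (V i) \<and> x i \<in> V i"
      "\<forall>a. (\<forall>i\<in>I. a i \<in> V i) \<longrightarrow> csum (\<lambda>i. smul (d i) (a i)) I \<in> U"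
    using csum_nbhd[of I r x U] I assms(1,4) by auto
  \<comment> \<open>Two nested sets are kept: mass can be bounded below only on the open
    \<open>B i\<close>, while averages of points of \<open>B i\<close> are only known to stay in the
    convex \<open>A i\<close>.\<close>
  have "\<forall>i\<in>I. \<exists>B A. openin X B \<and> cone_convex add smul A \<and> x i \<in> B \<and> B \<subseteq> A \<and> A \<subseteq> V i"
    using weakly_locally_convex dV(1) unfolding neighbourhood_base_of by blast
  then obtain B A where BA: "\<And>i. i \<in> I \<Longrightarrow> openin X (B i)" "\<And>i. i \<in> I \<Longrightarrow> cone_convex add smul (A i)"
      "\<And>i. i \<in> I \<Longrightarrow> x i \<in> B i" "\<And>i. i \<in> I \<Longrightarrow> B i \<subseteq> A i" "\<And>i. i \<in> I \<Longrightarrow> A i \<subseteq> V i"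
    by metis
  have AX: "A i \<subseteq> topspace X" if "i \<in> I" for i
    using BA(5)[OF that] dV(1) openin_subset that by blast
  \<comment> \<open>The empty set is excluded because its strict inequality would read 0 < 0.
    Intersecting with the whole space in \<open>W\<close> covers the case that \<open>F\<close> is
    empty.\<close>
  define F where "F = {K. K \<subseteq> I \<and> K \<noteq> {}}"
  define W where "W = (\<Inter>K\<in>F. {\<mu> \<in> simple_valuations X. \<mu> (\<Union>i\<in>K. B i) > ennreal (sum d K)}) \<inter> topspace (Vf X)"
  have finK: "finite K" if "K \<subseteq> I" for K using that I(1) finite_subset by blast
  have openB: "openin X (\<Union>i\<in>K. B i)" if "K \<subseteq> I" for K
    using BA(1) that by (intro openin_Union) auto
  have sumd: "0 \<le> sum d K" if "K \<subseteq> I" for K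
    using dV(1) that by (intro sum_nonneg) (auto intro: less_imp_le)
  have memW: "dirac_sum X m s y \<in> W \<longleftrightarrow>
      (\<forall>K\<in>F. sum d K < sum s {j. j < m \<and> y j \<in> (\<Union>i\<in>K. B i)})"
    if sy: "\<And>j. j < m \<Longrightarrow> 0 \<le> s j" "\<And>j. j < m \<Longrightarrow> y j \<in> topspace X" for m s y
  proof -
    have "ennreal (sum d K) < dirac_sum X m s y (\<Union>i\<in>K. B i) \<longleftrightarrow>
        sum d K < sum s {j. j < m \<and> y j \<in> (\<Union>i\<in>K. B i)}" if "K \<in> F" for K
    proof -
      have "K \<subseteq> I" using that by (simp add: F_def)
      then show ?thesis
        using sy(1) sumd by (subst dirac_sum_open[OF openB]) (auto simp: ennreal_less_iff)
    qed
    moreover have "dirac_sum X m s y \<in> simple_valuations X"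
      using sy by (rule dirac_sum_simple)
    ultimately show ?thesis by (simp add: W_def)
  qed
  show ?thesis
  proof (intro exI[of _ W] conjI allI impI)
    have "finite F" using I(1) by (simp add: F_def)
    then show "openin (Vf X) W"
      unfolding W_def using openB sumd by (intro openin_INT openin_Vf_subbasic) (auto simp: F_def)
    show "dirac_sum X n r x \<in> W"
    proof (subst memW)
      show "\<forall>K\<in>F. sum d K < sum r {j. j < n \<and> x j \<in> (\<Union>i\<in>K. B i)}"
      proof
        fix K assume "K \<in> F"
        then have K: "K \<subseteq> I" "K \<noteq> {}" by (auto simp: F_def)
        have "sum d K < sum r K"
          using K finK dV(1) by (intro sum_strict_mono) auto
        also have "\<dots> \<le> sum r {j. j < n \<and> x j \<in> (\<Union>i\<in>K. B i)}"
          using K BA(3) assms(2) by (intro sum_mono2) (auto simp: I_def)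
        finally show "sum d K < \<dots>" .
      qed
    qed (use assms in auto)
    fix m s y
    assume "(\<forall>j<m. 0 \<le> s j \<and> y j \<in> topspace X) \<and> dirac_sum X m s y \<in> W"
    then have s: "\<And>j. j < m \<Longrightarrow> 0 \<le> s j" and y: "\<And>j. j < m \<Longrightarrow> y j \<in> topspace X"
      and W: "dirac_sum X m s y \<in> W" by auto
    define J where "J = {..<m}"
    have J: "finite J" "\<And>j. j \<in> J \<Longrightarrow> 0 \<le> s j" "\<And>j. j \<in> J \<Longrightarrow> y j \<in> topspace X"
      using s y by (auto simp: J_def)
    \<comment> \<open>A transport plan: \<open>t i j\<close> is the part of the mass
      \<open>s j\<close> that is credited to \<open>x i\<close>. Every \<open>d i\<close> is met in
      full, whereas the \<open>s j\<close> need not be exhausted.\<close>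
    have "\<exists>t. (\<forall>i\<in>I. \<forall>j\<in>J. 0 \<le> t i j \<and> (t i j \<noteq> 0 \<longrightarrow> y j \<in> B i)) \<and>
             (\<forall>i\<in>I. sum (t i) J = d i) \<and> (\<forall>j\<in>J. (\<Sum>i\<in>I. t i j) \<le> s j)"
    proof (rule fractional_hall)
      fix K assume K: "K \<subseteq> I"
      have "{j \<in> J. \<exists>i\<in>K. y j \<in> B i} = {j. j < m \<and> y j \<in> (\<Union>i\<in>K. B i)}"
        by (auto simp: J_def)
      then show "sum d K \<le> sum s {j \<in> J. \<exists>i\<in>K. y j \<in> B i}"
        using W K memW[of m s y] s y by (cases "K = {}") (simp_all add: F_def less_imp_le)
    qed (use I(1) J dV(1) in \<open>simp_all add: less_imp_le\<close>)
    then obtain t where t: "\<And>i j. i \<in> I \<Longrightarrow> j \<in> J \<Longrightarrow> 0 \<le> t i j"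
        "\<And>i j. i \<in> I \<Longrightarrow> j \<in> J \<Longrightarrow> t i j \<noteq> 0 \<Longrightarrow> y j \<in> B i"
        "\<And>i. i \<in> I \<Longrightarrow> sum (t i) J = d i" "\<And>j. j \<in> J \<Longrightarrow> (\<Sum>i\<in>I. t i j) \<le> s j"
      by blast
    have "\<exists>a\<in>A i. csum (\<lambda>j. smul (t i j) (y j)) J = smul (d i) a" if i: "i \<in> I" for i
    proof -
      \<comment> \<open>Points \<open>y j\<close> that send nothing to \<open>x i\<close> may lie
        outside \<open>B i\<close> and must be dropped before convexity is used.\<close>
      define L where "L = {j \<in> J. t i j \<noteq> 0}"
      have sumL: "sum (t i) L = d i"
        unfolding t(3)[OF i, symmetric] using J(1) by (intro sum.mono_neutral_left) (auto simp: L_def)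
      have "csum (\<lambda>j. smul (t i j) (y j)) J = csum (\<lambda>j. smul (t i j) (y j)) L"
        using J t(1) i by (intro csum_neutral_subset) (auto simp: L_def smul_zero_left intro: smul_closed)
      moreover have "\<exists>a\<in>A i. csum (\<lambda>j. smul (t i j) (y j)) L = smul (sum (t i) L) a"
      proof (rule csum_convex)
        show "y j \<in> A i" if "j \<in> L" for j
          using t(2)[OF i, of j] that BA(4)[OF i] by (auto simp: L_def)
        show "0 < sum (t i) L"
          using sumL dV(1) i by simp
      qed (use J t i BA AX in \<open>auto simp: L_def\<close>)
      ultimately show ?thesis using sumL by simp
    qed
    then obtain a where a: "\<And>i. i \<in> I \<Longrightarrow> a i \<in> A i"
        "\<And>i. i \<in> I \<Longrightarrow> csum (\<lambda>j. smul (t i j) (y j)) J = smul (d i) (a i)"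
      by metis
    have aX: "a i \<in> topspace X" if "i \<in> I" for i using a(1) AX that by blast
    have "csum (\<lambda>i. smul (d i) (a i)) I = csum (\<lambda>i. csum (\<lambda>j. smul (t i j) (y j)) J) I"
      using a aX dV(1) by (intro csum_cong[symmetric]) (auto intro!: smul_closed less_imp_le)
    also have "\<dots> = csum (\<lambda>j. csum (\<lambda>i. smul (t i j) (y j)) I) J"
      using I J t(1) by (intro csum_swap[symmetric]) (auto intro: smul_closed)
    also have "\<dots> = csum (\<lambda>j. smul (\<Sum>i\<in>I. t i j) (y j)) J"
      using I J t(1) by (intro csum_cong csum_smul_left) (auto intro!: smul_closed sum_nonneg)
    finally have eq: "csum (\<lambda>i. smul (d i) (a i)) I = csum (\<lambda>j. smul (\<Sum>i\<in>I. t i j) (y j)) J" .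
    \<comment> \<open>The unassigned part of each \<open>s j\<close> only moves the sum up, and
      \<open>U\<close> is closed under going up.\<close>
    have "below (csum (\<lambda>j. smul (\<Sum>i\<in>I. t i j) (y j)) J) (csum (\<lambda>j. smul (s j) (y j)) J)"
      using J t(1,4) by (intro csum_below_mono smul_below_mono) (auto intro!: smul_closed sum_nonneg)
    moreover have "csum (\<lambda>i. smul (d i) (a i)) I \<in> U"
      using dV(2) a(1) BA(5) by blast
    ultimately show "combination m s y \<in> U"
      using assms(1) unfolding eq below_def combination_eq_csum J_def by blast
  qed
qed

lemma combination_below:
  assumes "\<And>i. i < n \<Longrightarrow> 0 \<le> r i" "\<And>i. i < n \<Longrightarrow> x i \<in> topspace X"
    and "\<And>j. j < m \<Longrightarrow> 0 \<le> s j" "\<And>j. j < m \<Longrightarrow> y j \<in> topspace X"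
    and "dirac_sum X n r x = dirac_sum X m s y"
  shows "below (combination n r x) (combination m s y)"
  unfolding below_def
proof (intro allI impI)
  fix U assume "openin X U \<and> combination n r x \<in> U"
  then obtain W where "dirac_sum X n r x \<in> W"
    and W: "\<And>m s y. (\<forall>j<m. 0 \<le> s j \<and> y j \<in> topspace X) \<and> dirac_sum X m s y \<in> W \<Longrightarrow>
      combination m s y \<in> U"
    using combination_nbhd[of U n r x, OF _ assms(1,2)] by blast
  then show "combination m s y \<in> U"
    using assms(3-5) by (intro W) simp
qed

lemma combination_unique:
  assumes "\<And>i. i < n \<Longrightarrow> 0 \<le> r i" "\<And>i. i < n \<Longrightarrow> x i \<in> topspace X"
    and "\<And>j. j < m \<Longrightarrow> 0 \<le> s j" "\<And>j. j < m \<Longrightarrow> y j \<in> topspace X"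
    and "dirac_sum X n r x = dirac_sum X m s y"
  shows "combination n r x = combination m s y"
proof (rule ccontr)
  assume "combination n r x \<noteq> combination m s y"
  moreover have "combination n r x \<in> topspace X" "combination m s y \<in> topspace X"
    using assms by (auto intro!: combination_closed)
  ultimately obtain U where "openin X U" "combination n r x \<notin> U \<longleftrightarrow> combination m s y \<in> U"
    using t0 unfolding t0_space_def by blast
  moreover have "below (combination n r x) (combination m s y)" "below (combination m s y) (combination n r x)"
    by (rule combination_below; use assms in simp)+
  ultimately show False by (auto simp: below_def)
qed

text \<open>A valuation has many representations; \<open>combination_unique\<close> makes the choice
  among them immaterial.\<close>

definition barycentre :: "('a set \<Rightarrow> ennreal) \<Rightarrow> 'a" where
  "barycentre \<mu> = (SOME b. \<exists>n r x. (\<forall>i<n. 0 \<le> r i \<and> x i \<in> topspace X) \<and>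
     \<mu> = dirac_sum X n r x \<and> b = combination n r x)"

lemma barycentre_dirac_sum:
  assumes "\<And>i. i < n \<Longrightarrow> 0 \<le> r i" "\<And>i. i < n \<Longrightarrow> x i \<in> topspace X"
  shows "barycentre (dirac_sum X n r x) = combination n r x"
proof -
  have "\<exists>b m s y. (\<forall>i<m. 0 \<le> s i \<and> y i \<in> topspace X) \<and>
      dirac_sum X n r x = dirac_sum X m s y \<and> b = combination m s y"
    using assms by blast
  from someI_ex[OF this] obtain m s y where "\<forall>i<m. 0 \<le> s i \<and> y i \<in> topspace X"
      "dirac_sum X n r x = dirac_sum X m s y" "barycentre (dirac_sum X n r x) = combination m s y"
    unfolding barycentre_def[symmetric] by blast
  with combination_unique[of n r x m s y] assms show ?thesis by auto
qed

lemma barycentre_closed: "\<mu> \<in> simple_valuations X \<Longrightarrow> barycentre \<mu> \<in> topspace X"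
  by (elim simple_valuationsE) (simp add: barycentre_dirac_sum combination_closed)

lemma continuous_barycentre: "continuous_map (Vf X) X barycentre"
  unfolding continuous_map_def
proof (intro conjI allI impI)
  show "barycentre \<in> topspace (Vf X) \<rightarrow> topspace X"
    using barycentre_closed by simp
  fix U assume U: "openin X U"
  show "openin (Vf X) {\<mu> \<in> topspace (Vf X). barycentre \<mu> \<in> U}"
  proof (subst openin_subopen, intro ballI)
    fix \<mu> assume "\<mu> \<in> {\<mu> \<in> topspace (Vf X). barycentre \<mu> \<in> U}"
    then have \<mu>: "\<mu> \<in> simple_valuations X" "barycentre \<mu> \<in> U" by auto
    obtain n r x where eq: "\<mu> = dirac_sum X n r x"
        and rx: "\<And>i. i < n \<Longrightarrow> 0 \<le> r i" "\<And>i. i < n \<Longrightarrow> x i \<in> topspace X"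
      using \<mu>(1) by (rule simple_valuationsE) (rule that)
    have "combination n r x \<in> U"
      using \<mu>(2) barycentre_dirac_sum[OF rx] eq by simp
    from combination_nbhd[OF U rx this] obtain W where
        W: "openin (Vf X) W" "dirac_sum X n r x \<in> W"
      and WU: "\<And>m s y. (\<forall>j<m. 0 \<le> s j \<and> y j \<in> topspace X) \<and> dirac_sum X m s y \<in> W \<Longrightarrow>
        combination m s y \<in> U"
      by blast
    have "barycentre \<nu> \<in> U" if "\<nu> \<in> W" "\<nu> \<in> simple_valuations X" for \<nu>
      using that(2) by (rule simple_valuationsE) (use that(1) WU barycentre_dirac_sum in auto)
    moreover have "W \<subseteq> simple_valuations X"
      using openin_subset[OF W(1)] by simp
    ultimately show "\<exists>T. openin (Vf X) T \<and> \<mu> \<in> T \<and> T \<subseteq> {\<mu> \<in> topspace (Vf X). barycentre \<mu> \<in> U}"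
      using W eq by (intro exI[of _ W]) auto
  qed
qed

lemma barycentre_add:
  assumes "\<mu> \<in> simple_valuations X" "\<nu> \<in> simple_valuations X"
  shows "barycentre (val_add \<mu> \<nu>) = add (barycentre \<mu>) (barycentre \<nu>)"
proof -
  obtain n r x where \<mu>: "\<mu> = dirac_sum X n r x" "\<And>i. i < n \<Longrightarrow> 0 \<le> r i" "\<And>i. i < n \<Longrightarrow> x i \<in> topspace X"
    using assms(1) by (rule simple_valuationsE) (rule that)
  obtain m s y where \<nu>: "\<nu> = dirac_sum X m s y" "\<And>i. i < m \<Longrightarrow> 0 \<le> s i" "\<And>i. i < m \<Longrightarrow> y i \<in> topspace X"
    using assms(2) by (rule simple_valuationsE) (rule that)
  show ?thesis
    unfolding \<mu>(1) \<nu>(1) val_add_dirac_sum using \<mu>(2,3) \<nu>(2,3)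
    by (simp add: barycentre_dirac_sum add_combination)
qed

lemma barycentre_scale:
  assumes "0 \<le> c" "\<mu> \<in> simple_valuations X"
  shows "barycentre (val_scale c \<mu>) = smul c (barycentre \<mu>)"
  using assms(2)
  by (rule simple_valuationsE)
    (use assms(1) in \<open>simp add: val_scale_dirac_sum barycentre_dirac_sum smul_combination\<close>)

text \<open>By \<open>barycentre_dirac_sum\<close> the right-hand side is also the barycentre of the
  Dirac sum over the barycentres of the \<open>M i\<close>. This gives the multiplication law in the
  form of \<open>Vf_algebra_iff\<close>.\<close>

lemma barycentre_combination:
  assumes "\<And>i. i < n \<Longrightarrow> 0 \<le> r i" "\<And>i. i < n \<Longrightarrow> M i \<in> simple_valuations X"
  shows "barycentre (val_combination n r M) = combination n r (\<lambda>i. barycentre (M i))"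
  using assms
proof (induction n)
  case 0
  show ?case
    using barycentre_dirac_sum[of 0] by (simp add: dirac_sum_eq val_combination_0 combination_0)
next
  case (Suc n)
  then have "barycentre (val_combination (Suc n) r M) =
      add (barycentre (val_combination n r M)) (barycentre (val_scale (r n) (M n)))"
    unfolding val_combination_Suc by (intro barycentre_add val_combination_simple val_scale_simple) auto
  with Suc show ?case
    by (subst combination_Suc) (auto simp: barycentre_scale barycentre_closed)
qed

lemma barycentre_dirac: "x \<in> topspace X \<Longrightarrow> barycentre (dirac X x) = x"
  unfolding dirac_eq_dirac_sum
  by (subst barycentre_dirac_sum)
    (simp_all add: combination_Suc combination_0 add_zero_left smul_one)

lemma barycentre_algebra: "Vf_algebra X barycentre"
  unfolding Vf_algebra_iff
  using t0 continuous_barycentre barycentre_dirac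
  by (auto simp: barycentre_combination barycentre_dirac_sum barycentre_closed)

lemma barycentre_continuous_linear:
  "is_continuous_linear_barycentre_map X add zero smul barycentre"
  unfolding is_continuous_linear_barycentre_map_def cone_linear_def is_barycentre_map_def
  using continuous_barycentre
  by (auto simp: barycentre_add barycentre_scale val_scale_simple barycentre_dirac_sum)

text \<open>Simple valuations exhaust \<open>Vf X\<close>, so the prescribed values determine the
  map.\<close>

lemma barycentre_map_unique:
  assumes "is_barycentre_map X add zero smul \<gamma>" "\<mu> \<in> simple_valuations X"
  shows "\<gamma> \<mu> = barycentre \<mu>"
  using assms(2)
  by (rule simple_valuationsE)
    (use assms(1) in \<open>simp add: is_barycentre_map_def barycentre_dirac_sum\<close>)

end

theorem theorem5p9:
  fixes X :: "'a topology" and \<alpha> :: "('a set \<Rightarrow> ennreal) \<Rightarrow> 'a"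
    and C :: "'b topology" and add :: "'b \<Rightarrow> 'b \<Rightarrow> 'b" and zero :: 'b and smul :: "real \<Rightarrow> 'b \<Rightarrow> 'b"
  shows
    "(t0_space X \<and> continuous_map (Vf X) X \<alpha> \<and> Vf_algebra X \<alpha> \<longrightarrow>
       (\<exists>z. weakly_locally_convex_topological_cone X
              (\<lambda>x y. \<alpha> (val_add (dirac X x) (dirac X y))) z
              (\<lambda>r x. \<alpha> (val_scale r (dirac X x))) \<and>
            is_barycentre_map X
              (\<lambda>x y. \<alpha> (val_add (dirac X x) (dirac X y))) z
              (\<lambda>r x. \<alpha> (val_scale r (dirac X x))) \<alpha>))
     \<and>
     (weakly_locally_convex_topological_cone C add zero smul \<longrightarrow>
       (\<exists>\<beta>. is_continuous_linear_barycentre_map C add zero smul \<beta> \<and>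
            (\<forall>\<gamma>. is_continuous_linear_barycentre_map C add zero smul \<gamma> \<longrightarrow>
                 (\<forall>\<mu>\<in>topspace (Vf C). \<gamma> \<mu> = \<beta> \<mu>)) \<and>
            Vf_algebra C \<beta>))"
proof (intro conjI impI)
  assume "t0_space X \<and> continuous_map (Vf X) X \<alpha> \<and> Vf_algebra X \<alpha>"
  then interpret simple_valuation_algebra X \<alpha>
    by unfold_locales simp
  show "\<exists>z. weakly_locally_convex_topological_cone X
              (\<lambda>x y. \<alpha> (val_add (dirac X x) (dirac X y))) z
              (\<lambda>r x. \<alpha> (val_scale r (dirac X x))) \<and>
            is_barycentre_map X
              (\<lambda>x y. \<alpha> (val_add (dirac X x) (dirac X y))) z
              (\<lambda>r x. \<alpha> (val_scale r (dirac X x))) \<alpha>"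
    \<comment> \<open>The witness for \<open>z\<close> is the image of the zero valuation, the only
      possible one since neutral elements are unique.\<close>
    using weakly_locally_convex_cone barycentre_map
    unfolding alg_add_def[abs_def] alg_smul_def[abs_def] by blast
next
  assume "weakly_locally_convex_topological_cone C add zero smul"
  then interpret weakly_locally_convex_topological_cone C add zero smul .
  show "\<exists>\<beta>. is_continuous_linear_barycentre_map C add zero smul \<beta> \<and>
            (\<forall>\<gamma>. is_continuous_linear_barycentre_map C add zero smul \<gamma> \<longrightarrow>
                 (\<forall>\<mu>\<in>topspace (Vf C). \<gamma> \<mu> = \<beta> \<mu>)) \<and>
            Vf_algebra C \<beta>"
    using barycentre_continuous_linear barycentre_algebra barycentre_map_unique
    by (intro exI[of _ barycentre]) (auto simp: is_continuous_linear_barycentre_map_def)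
qed

end
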